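(* There exist $f\in\mathbb{N}^{\mathbb{N}}$ and $A\in 2^{\mathbb{N}}$ such that $f$ strongly relativizes $\Delta^0_1$ at $\mathbb{N}^{\mathbb{N}}$ and $f\equiv_T A$, but $A$ does not strongly relativize $\Delta^0_1$ at $\mathbb{N}^{\mathbb{N}}$, or even at $\mathbb{N}$. In particular, there exists $f\in\mathbb{N}^{\mathbb{N}}$ which strongly relativizes $\Delta^0_1$ at $\mathbb{N}^{\mathbb{N}}$ but is not computably dominated.
   Context: Elements of $2^{\mathbb{N}}$ are also regarded as elements of $\mathbb{N}^{\mathbb{N}}$. Let $\mathcal{X}$ be $\mathbb{N}$ or $\mathbb{N}^{\mathbb{N}}$. A subset of $\mathbb{N}^{\mathbb{N}}\times\mathcal{X}$ is $\Sigma^0_1$ if it is the union of a c.e. family of basic open sets $[\sigma]\times N$, where $[\sigma]=\{h\in\mathbb{N}^{\mathbb{N}}:\sigma\sqsubset h\}$ for a finite sequence $\sigma$, and $N$ is $\{n\}$ with $n\in\mathbb{N}$ (if $\mathcal{X}=\mathbb{N}$) or $[\tau]$ with $\tau$ a finite sequence (if $\mathcal{X}=\mathbb{N}^{\mathbb{N}}$); it is $\Delta^0_1$ if both it and its complement are $\Sigma^0_1$. For $f\in\mathbb{N}^{\mathbb{N}}$, $Q_f=\{x\in\mathcal{X}:Q(f,x)\}$. A set $P\subseteq\mathcal{X}$ is $\Delta^0_1(f)$ if both $P$ and its complement are $f$-sections of $\Sigma^0_1$ subsets of $\mathbb{N}^{\mathbb{N}}\times\mathcal{X}$. $f$ strongly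 relativizes $\Delta^0_1$ at $\mathcal{X}$ if every $\Delta^0_1(f)$ set $P\subseteq\mathcal{X}$ equals $Q_f$ for some $\Delta^0_1$ set $Q\subseteq\mathbb{N}^{\mathbb{N}}\times\mathcal{X}$. A real $f\in\mathbb{N}^{\mathbb{N}}$ is computably dominated if for every $g\in\mathbb{N}^{\mathbb{N}}$ with $g\le_T f$ there is a computable $h\in\mathbb{N}^{\mathbb{N}}$ with $g(n)\le h(n)$ for all $n$. *)

theory Defs
  imports Main "HOL-Library.Nat_Bijection"
begin

text \<open>
  Kleene's recursion schemes with an oracle. The oracle is a partial function, so that a single
  evaluation relation covers total oracles (\<^term>\<open>Some \<circ> f\<close>) and oracle-free computation
  (\<^term>\<open>Map.empty\<close>, for which the scheme \<open>Query\<close> never returns a value).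
\<close>

datatype recf =
    Zero
  | Succ
  | Proj nat
  | Query
  | Comp recf "recf list"
  | PrimRec recf recf
  | Mu recf

inductive evals :: "(nat \<Rightarrow> nat option) \<Rightarrow> recf \<Rightarrow> nat list \<Rightarrow> nat \<Rightarrow> bool"
  for orc :: "nat \<Rightarrow> nat option" where
  zero: "evals orc Zero xs 0"
| succ: "evals orc Succ [x] (Suc x)"
| proj: "i < length xs \<Longrightarrow> evals orc (Proj i) xs (xs ! i)"
| query: "orc x = Some y \<Longrightarrow> evals orc Query [x] y"
| comp: "list_all2 (\<lambda>h y. evals orc h xs y) hs ys \<Longrightarrow> evals orc c ys z \<Longrightarrow>
    evals orc (Comp c hs) xs z"
| primrec_0: "evals orc c xs y \<Longrightarrow> evals orc (PrimRec c d) (0 # xs) y"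
| primrec_Suc: "evals orc (PrimRec c d) (n # xs) y \<Longrightarrow> evals orc d (n # y # xs) z \<Longrightarrow>
    evals orc (PrimRec c d) (Suc n # xs) z"
| mu: "evals orc c (n # xs) 0 \<Longrightarrow> (\<And>m. m < n \<Longrightarrow> \<exists>y>0. evals orc c (m # xs) y) \<Longrightarrow>
    evals orc (Mu c) xs n"

definition computable :: "(nat \<Rightarrow> nat) \<Rightarrow> bool" where
  "computable h \<longleftrightarrow> (\<exists>c. \<forall>n. evals Map.empty c [n] (h n))"

definition turing_le :: "(nat \<Rightarrow> nat) \<Rightarrow> (nat \<Rightarrow> nat) \<Rightarrow> bool" (infix "\<le>\<^sub>T" 50) where
  "g \<le>\<^sub>T f \<longleftrightarrow> (\<exists>c. \<forall>n. evals (Some \<circ> f) c [n] (g n))"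

definition turing_equiv :: "(nat \<Rightarrow> nat) \<Rightarrow> (nat \<Rightarrow> nat) \<Rightarrow> bool" (infix "\<equiv>\<^sub>T" 50) where
  "f \<equiv>\<^sub>T g \<longleftrightarrow> f \<le>\<^sub>T g \<and> g \<le>\<^sub>T f"

definition computably_enumerable :: "nat set \<Rightarrow> bool" where
  "computably_enumerable W \<longleftrightarrow> W = {} \<or> (\<exists>h. computable h \<and> W = range h)"

definition computably_dominated :: "(nat \<Rightarrow> nat) \<Rightarrow> bool" where
  "computably_dominated f \<longleftrightarrow>
    (\<forall>g. g \<le>\<^sub>T f \<longrightarrow> (\<exists>h. computable h \<and> (\<forall>n. g n \<le> h n)))"

text \<open>Cantor space as a subset of Baire space.\<close>

definition cantor_space :: "(nat \<Rightarrow> nat) set" where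
  "cantor_space = {A. \<forall>n. A n \<in> {0, 1}}"

definition cylinder :: "nat list \<Rightarrow> (nat \<Rightarrow> nat) set" where
  "cylinder \<sigma> = {h. \<forall>i < length \<sigma>. h i = \<sigma> ! i}"

text \<open>
  The notions below take as parameter \<open>B\<close> an enumeration of the basic open sets of the space
  \<open>\<X>\<close>, which is the whole type \<^typ>\<open>'x\<close>: \<open>nat_basis\<close> for the natural numbers and
  \<open>baire_basis\<close> for Baire space.
\<close>

definition nat_basis :: "nat \<Rightarrow> nat set" where
  "nat_basis n = {n}"

definition baire_basis :: "nat \<Rightarrow> (nat \<Rightarrow> nat) set" where
  "baire_basis k = cylinder (list_decode k)"

text \<open>A family of basic open sets is given by a set of codes \<^term>\<open>prod_encode (list_encode \<sigma>, j)\<close>.\<close>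

definition Sigma01 :: "(nat \<Rightarrow> 'x set) \<Rightarrow> ((nat \<Rightarrow> nat) \<times> 'x) set \<Rightarrow> bool" where
  "Sigma01 B S \<longleftrightarrow> (\<exists>W. computably_enumerable W \<and>
    S = \<Union> {cylinder \<sigma> \<times> B j | \<sigma> j. prod_encode (list_encode \<sigma>, j) \<in> W})"

definition Delta01 :: "(nat \<Rightarrow> 'x set) \<Rightarrow> ((nat \<Rightarrow> nat) \<times> 'x) set \<Rightarrow> bool" where
  "Delta01 B Q \<longleftrightarrow> Sigma01 B Q \<and> Sigma01 B (- Q)"

definition sect :: "((nat \<Rightarrow> nat) \<times> 'x) set \<Rightarrow> (nat \<Rightarrow> nat) \<Rightarrow> 'x set" where
  "sect Q f = {x. (f, x) \<in> Q}"

definition Delta01_in :: "(nat \<Rightarrow> 'x set) \<Rightarrow> (nat \<Rightarrow> nat) \<Rightarrow> 'x set \<Rightarrow> bool" where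
  "Delta01_in B f P \<longleftrightarrow>
    (\<exists>U V. Sigma01 B U \<and> Sigma01 B V \<and> P = sect U f \<and> - P = sect V f)"

definition strongly_relativizes_Delta01 :: "(nat \<Rightarrow> 'x set) \<Rightarrow> (nat \<Rightarrow> nat) \<Rightarrow> bool" where
  "strongly_relativizes_Delta01 B f \<longleftrightarrow>
    (\<forall>P. Delta01_in B f P \<longrightarrow> (\<exists>Q. Delta01 B Q \<and> P = sect Q f))"

end

theory Submission imports Defs
begin

text \<open>
  If \<open>{f}\<close> is a \<open>\<Pi>\<^sup>0\<^sub>1\<close> class, then \<open>f\<close> strongly relativizes \<open>\<Delta>\<^sup>0\<^sub>1\<close>: for complementary sections \<open>U\<^sub>f\<close> and \<open>V\<^sub>f\<close>,
  the sets \<open>U\<close> and \<open>V\<close>, each enlarged by the \<open>\<Sigma>\<^sup>0\<^sub>1\<close> set of all \<open>(g, x)\<close> with \<open>g \<noteq> f\<close>, cover the space, and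
  effective reduction yields a \<open>\<Delta>\<^sup>0\<^sub>1\<close> set that agrees with \<open>U\<close> on the section at \<open>f\<close>.

  Take for \<open>f\<close> the totalized universal function, where \<open>f (e, x)\<close> is \<open>1\<close> if the program \<open>e\<close> diverges at \<open>x\<close>,
  and \<open>y + 2\<close> if it returns \<open>y\<close>. Its values on composite programs satisfy local conditions in terms of its
  values on the components, and these conditions determine \<open>f\<close> by induction on programs; divergence of
  a minimization is a \<open>\<Pi>\<^sup>0\<^sub>1\<close> condition in the values of \<open>f\<close>. So \<open>{f}\<close> is \<open>\<Pi>\<^sup>0\<^sub>1\<close>, and by diagonalization
  no computable function bounds \<open>f\<close>.

  For the graph \<open>A\<close> of \<open>f\<close>, compactness of Cantor space turns a \<open>\<Delta>\<^sup>0\<^sub>1\<close> set \<open>Q\<close> into a truth-table reduction,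
  given by two computable functions. As \<open>f\<close> evaluates these, an \<open>A\<close>-decidable set of numbers can
  diagonalize against all sections \<open>Q\<^sub>A\<close>.
\<close>

section \<open>Closure properties of computability relative to an oracle\<close>

text \<open>The schemes act on lists, so closure under recursion is first shown at fixed arities;
  pairing then lets later arguments use the unary \<open>computable_in\<close>.\<close>

definition computable_fun :: "(nat \<Rightarrow> nat option) \<Rightarrow> nat \<Rightarrow> (nat list \<Rightarrow> nat) \<Rightarrow> bool" where
  "computable_fun orc k F \<longleftrightarrow> (\<exists>c. \<forall>xs. length xs = k \<longrightarrow> evals orc c xs (F xs))"

definition computable_in :: "(nat \<Rightarrow> nat option) \<Rightarrow> (nat \<Rightarrow> nat) \<Rightarrow> bool" where
  "computable_in orc F \<longleftrightarrow> (\<exists>c. \<forall>n. evals orc c [n] (F n))"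

lemma computable_iff: "computable h \<longleftrightarrow> computable_in Map.empty h"
  by (simp add: computable_def computable_in_def)

lemma turing_le_iff: "g \<le>\<^sub>T f \<longleftrightarrow> computable_in (Some \<circ> f) g"
  by (simp add: turing_le_def computable_in_def)

lemma computable_in_iff: "computable_in orc F \<longleftrightarrow> computable_fun orc 1 (\<lambda>xs. F (xs ! 0))"
proof
  assume "computable_in orc F"
  then show "computable_fun orc 1 (\<lambda>xs. F (xs ! 0))"
    unfolding computable_in_def computable_fun_def by (force simp: length_Suc_conv)
next
  assume "computable_fun orc 1 (\<lambda>xs. F (xs ! 0))"
  then obtain c where "\<And>xs. length xs = 1 \<Longrightarrow> evals orc c xs (F (xs ! 0))"
    unfolding computable_fun_def by auto
  from this [of "[_]"] show "computable_in orc F"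
    unfolding computable_in_def by auto
qed

named_theorems computable_fun_intros

lemma computable_fun_zero [computable_fun_intros]: "computable_fun orc k (\<lambda>xs. 0)"
  unfolding computable_fun_def by (blast intro: evals.zero)

lemma computable_fun_proj [computable_fun_intros]: "i < k \<Longrightarrow> computable_fun orc k (\<lambda>xs. xs ! i)"
  unfolding computable_fun_def by (blast intro: evals.proj)

lemma computable_fun_comp:
  assumes F: "computable_fun orc m F" and "length Gs = m"
    and "\<And>G. G \<in> set Gs \<Longrightarrow> computable_fun orc k G"
  shows "computable_fun orc k (\<lambda>xs. F (map (\<lambda>G. G xs) Gs))"
proof -
  obtain c where c: "\<And>xs. length xs = m \<Longrightarrow> evals orc c xs (F xs)"
    using F unfolding computable_fun_def by auto
  have "\<forall>G \<in> set Gs. \<exists>h. \<forall>xs. length xs = k \<longrightarrow> evals orc h xs (G xs)"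
    using assms(3) unfolding computable_fun_def by auto
  then obtain h where h: "\<And>G xs. G \<in> set Gs \<Longrightarrow> length xs = k \<Longrightarrow> evals orc (h G) xs (G xs)"
    by metis
  have "evals orc (Comp c (map h Gs)) xs (F (map (\<lambda>G. G xs) Gs))" if "length xs = k" for xs
    by (rule evals.comp [where ys = "map (\<lambda>G. G xs) Gs"])
      (auto intro!: c h simp: list_all2_conv_all_nth that \<open>length Gs = m\<close>)
  then show ?thesis
    unfolding computable_fun_def by blast
qed

lemma computable_fun_comp1:
  assumes "computable_fun orc 1 (\<lambda>xs. F (xs ! 0))" "computable_fun orc k G"
  shows "computable_fun orc k (\<lambda>xs. F (G xs))"
  using computable_fun_comp [OF assms(1), of "[G]" k] assms(2) by simp

lemma computable_fun_comp2:
  assumes "computable_fun orc 2 (\<lambda>xs. F (xs ! 0) (xs ! 1))"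
    "computable_fun orc k G" "computable_fun orc k H"
  shows "computable_fun orc k (\<lambda>xs. F (G xs) (H xs))"
  using computable_fun_comp [OF assms(1), of "[G, H]" k] assms(2,3) by auto

lemma computable_fun_Suc [computable_fun_intros]:
  assumes "computable_fun orc k G"
  shows "computable_fun orc k (\<lambda>xs. Suc (G xs))"
proof -
  have "computable_in orc Suc"
    unfolding computable_in_def by (blast intro: evals.succ)
  then show ?thesis
    using assms by (metis computable_in_iff computable_fun_comp1)
qed

lemma computable_fun_rec_nat:
  assumes F: "computable_fun orc 1 (\<lambda>xs. F (xs ! 0))"
    and H: "computable_fun orc 3 (\<lambda>xs. H (xs ! 0) (xs ! 1) (xs ! 2))"
    and A: "computable_fun orc k A" and N: "computable_fun orc k N"
  shows "computable_fun orc k (\<lambda>xs. rec_nat (F (A xs)) (\<lambda>i v. H i v (A xs)) (N xs))"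
proof -
  from F obtain c where "\<And>xs. length xs = 1 \<Longrightarrow> evals orc c xs (F (xs ! 0))"
    unfolding computable_fun_def by auto
  from this [of "[_]"] have c: "evals orc c [x] (F x)" for x by auto
  from H obtain d where "\<And>xs. length xs = 3 \<Longrightarrow> evals orc d xs (H (xs ! 0) (xs ! 1) (xs ! 2))"
    unfolding computable_fun_def by auto
  from this [of "[_, _, _]"] have d: "evals orc d [i, v, x] (H i v x)" for i v x by auto
  have "evals orc (PrimRec c d) [n, x] (rec_nat (F x) (\<lambda>i v. H i v x) n)" for n x
    by (induction n) (auto intro: evals.primrec_0 evals.primrec_Suc c d)
  then have "computable_fun orc 2 (\<lambda>xs. rec_nat (F (xs ! 1)) (\<lambda>i v. H i v (xs ! 1)) (xs ! 0))"
    unfolding computable_fun_def by (intro exI [of _ "PrimRec c d"]) (auto simp: length_Suc_conv numeral_2_eq_2)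
  from computable_fun_comp2 [OF this N A] show ?thesis .
qed

lemma computable_fun_rec_nat_const:
  assumes H: "computable_fun orc 2 (\<lambda>xs. H (xs ! 0) (xs ! 1))"
    and N: "computable_fun orc k N"
  shows "computable_fun orc k (\<lambda>xs. rec_nat 0 H (N xs))"
  by (rule computable_fun_rec_nat [of _ "\<lambda>x. 0" "\<lambda>i v x. H i v" _ "\<lambda>xs. 0"])
    (intro computable_fun_intros computable_fun_comp2 [OF H] N; simp)+

lemma computable_fun_add [computable_fun_intros]:
  assumes "computable_fun orc k F" "computable_fun orc k G"
  shows "computable_fun orc k (\<lambda>xs. F xs + G xs)"
proof -
  have *: "n + m = rec_nat m (\<lambda>i v. Suc v) n" for n m :: nat by (induction n) auto
  show ?thesis unfolding *
    by (rule computable_fun_rec_nat [of _ "\<lambda>x. x" "\<lambda>i v x. Suc v"]; intro computable_fun_intros assms; simp)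
qed

lemma computable_fun_diff [computable_fun_intros]:
  assumes "computable_fun orc k F" "computable_fun orc k G"
  shows "computable_fun orc k (\<lambda>xs. F xs - G xs)"
proof -
  have *: "n - 1 = rec_nat 0 (\<lambda>i v. i) n" for n :: nat by (induction n) auto
  have pred: "computable_fun orc 1 (\<lambda>xs. xs ! 0 - 1)"
    unfolding * by (rule computable_fun_rec_nat_const; intro computable_fun_intros; simp)
  have **: "n - m = rec_nat n (\<lambda>i v. v - 1) m" for n m :: nat by (induction m) auto
  have "computable_fun orc k (\<lambda>xs. rec_nat (F xs) (\<lambda>i v. v - 1) (G xs))"
    by (rule computable_fun_rec_nat [of _ "\<lambda>x. x" "\<lambda>i v x. v - 1"];
        intro computable_fun_intros assms computable_fun_comp1 [OF pred, of _ "\<lambda>xs. xs ! 1"]; simp)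
  then show ?thesis by (simp only: ** [symmetric])
qed

lemma computable_fun_triangle [computable_fun_intros]:
  assumes "computable_fun orc k F"
  shows "computable_fun orc k (\<lambda>xs. triangle (F xs))"
proof -
  have *: "triangle n = rec_nat 0 (\<lambda>i v. v + Suc i) n" for n by (induction n) auto
  show ?thesis unfolding *
    by (rule computable_fun_rec_nat_const; intro computable_fun_intros assms; simp)
qed

section \<open>Pairing and its projections\<close>

definition pfst :: "nat \<Rightarrow> nat" where "pfst n = fst (prod_decode n)"
definition psnd :: "nat \<Rightarrow> nat" where "psnd n = snd (prod_decode n)"

lemma pfst_prod_encode [simp]: "pfst (prod_encode (a, b)) = a"
  and psnd_prod_encode [simp]: "psnd (prod_encode (a, b)) = b"
  and prod_encode_pfst_psnd [simp]: "prod_encode (pfst n, psnd n) = n"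
  by (simp_all add: pfst_def psnd_def)

lemma pfst_0 [simp]: "pfst 0 = 0" and psnd_0 [simp]: "psnd 0 = 0"
  using pfst_prod_encode [of 0 0] psnd_prod_encode [of 0 0] by (simp_all add: prod_encode_def)

lemma pfst_le: "pfst n \<le> n" and psnd_le: "psnd n \<le> n"
  by (metis prod_encode_pfst_psnd le_prod_encode_1, metis prod_encode_pfst_psnd le_prod_encode_2)

text \<open>The diagonal \<^term>\<open>pfst n + psnd n\<close> on which \<open>n\<close> lies is computed by primitive recursion;
  the two components are then differences.\<close>

lemma diagonal_rec:
  "pfst n + psnd n = rec_nat 0 (\<lambda>i v. v + (1 - (triangle (Suc v) - Suc i))) n"
proof (induction n)
  case (Suc n)
  define a b where "a = pfst n" and "b = psnd n"
  have n: "n = prod_encode (a, b)" by (simp add: a_def b_def)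
  have "Suc n = (if b = 0 then prod_encode (0, Suc a) else prod_encode (Suc a, b - 1))"
    by (cases b) (simp_all add: n prod_encode_def)
  then have "pfst (Suc n) + psnd (Suc n) = (if b = 0 then Suc (a + b) else a + b)"
    by (cases "b = 0") simp_all
  \<comment> \<open>The inner difference equals \<open>b\<close>, so the outer one tests whether
    \<open>n\<close> is the last point of its diagonal.\<close>
  moreover have "1 - (triangle (Suc (a + b)) - Suc n) = (if b = 0 then 1 else 0)"
    by (simp add: n prod_encode_def)
  ultimately show ?case
    using Suc.IH by (simp flip: Suc.IH add: a_def b_def)
qed simp

lemma pfst_eq: "pfst n = n - triangle (pfst n + psnd n)"
proof -
  have "triangle (pfst n + psnd n) + pfst n = n"
    using prod_encode_pfst_psnd [of n] unfolding prod_encode_def prod.case .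
  then show ?thesis by linarith
qed

lemma computable_fun_diagonal [computable_fun_intros]:
  assumes "computable_fun orc k F"
  shows "computable_fun orc k (\<lambda>xs. pfst (F xs) + psnd (F xs))"
  unfolding diagonal_rec One_nat_def
  by (rule computable_fun_rec_nat_const; intro computable_fun_intros assms; simp)

named_theorems computable_intros

lemma computable_in_comp:
  assumes "computable_in orc F" "computable_in orc G"
  shows "computable_in orc (\<lambda>n. F (G n))"
  using assms computable_fun_comp1 unfolding computable_in_iff by blast

lemma computable_in_id [computable_intros]: "computable_in orc (\<lambda>n. n)"
  unfolding computable_in_iff by (intro computable_fun_intros) auto

lemma computable_in_Suc [computable_intros]:
  "computable_in orc F \<Longrightarrow> computable_in orc (\<lambda>n. Suc (F n))"
  unfolding computable_in_iff by (intro computable_fun_intros)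

lemma computable_in_const [computable_intros]: "computable_in orc (\<lambda>_. k)"
proof (induction k)
  case 0
  show ?case unfolding computable_in_iff by (rule computable_fun_zero)
qed (rule computable_in_Suc)

lemma computable_in_add [computable_intros]:
  "computable_in orc F \<Longrightarrow> computable_in orc G \<Longrightarrow> computable_in orc (\<lambda>n. F n + G n)"
  unfolding computable_in_iff by (intro computable_fun_intros)

lemma computable_in_diff [computable_intros]:
  "computable_in orc F \<Longrightarrow> computable_in orc G \<Longrightarrow> computable_in orc (\<lambda>n. F n - G n)"
  unfolding computable_in_iff by (intro computable_fun_intros)

lemma computable_in_prod_encode [computable_intros]:
  assumes "computable_in orc F" "computable_in orc G"
  shows "computable_in orc (\<lambda>n. prod_encode (F n, G n))"
  using assms unfolding computable_in_iff prod_encode_def prod.case by (intro computable_fun_intros)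

lemma computable_in_pfst [computable_intros]:
  assumes "computable_in orc F"
  shows "computable_in orc (\<lambda>n. pfst (F n))"
proof -
  have "computable_in orc (\<lambda>n. F n - triangle (pfst (F n) + psnd (F n)))"
    using assms unfolding computable_in_iff by (intro computable_fun_intros)
  then show ?thesis by (simp flip: pfst_eq)
qed

lemma computable_in_psnd [computable_intros]:
  assumes "computable_in orc F"
  shows "computable_in orc (\<lambda>n. psnd (F n))"
proof -
  have "computable_in orc (\<lambda>n. pfst (F n) + psnd (F n))"
    using assms unfolding computable_in_iff by (intro computable_fun_intros)
  from computable_in_diff [OF this computable_in_pfst [OF assms]] show ?thesis by simp
qed

lemma computable_in_rec_nat [computable_intros]:
  assumes a: "computable_in orc a" and b: "computable_in orc b"
    and s: "computable_in orc (\<lambda>p. s (pfst p) (pfst (psnd p)) (psnd (psnd p)))"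
  shows "computable_in orc (\<lambda>n. rec_nat (a n) (\<lambda>i v. s n i v) (b n))"
proof -
  have pair: "computable_fun orc 2 (\<lambda>xs. prod_encode (xs ! 0, xs ! 1))"
    unfolding prod_encode_def prod.case by (intro computable_fun_intros) auto
  have proj: "computable_fun orc 3 (\<lambda>xs. xs ! 0)" "computable_fun orc 3 (\<lambda>xs. xs ! 1)"
    "computable_fun orc 3 (\<lambda>xs. xs ! 2)"
    by (intro computable_fun_proj; simp)+
  note triple = computable_fun_comp2 [OF pair proj(3) computable_fun_comp2 [OF pair proj(1) proj(2)]]
  note computable_fun_comp1 [OF s [unfolded computable_in_iff] triple]
  then have "computable_fun orc 3 (\<lambda>xs. s (xs ! 2) (xs ! 0) (xs ! 1))" by simp
  then show ?thesis
    using a b unfolding computable_in_iff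
    by (intro computable_fun_rec_nat [of orc a "\<lambda>i v x. s x i v" 1 "\<lambda>xs. xs ! 0" "\<lambda>xs. b (xs ! 0)"])
      (auto intro: computable_fun_intros)
qed

lemma computable_in_oracle [computable_intros]:
  assumes "computable_in (Some \<circ> f) F"
  shows "computable_in (Some \<circ> f) (\<lambda>n. f (F n))"
proof -
  have "computable_in (Some \<circ> f) f"
    unfolding computable_in_def by (intro exI [of _ Query] allI evals.query) simp
  then show ?thesis using assms by (rule computable_in_comp)
qed

section \<open>Decidable predicates and search\<close>

definition decidable_in :: "(nat \<Rightarrow> nat option) \<Rightarrow> (nat \<Rightarrow> bool) \<Rightarrow> bool" where
  "decidable_in orc P \<longleftrightarrow> computable_in orc (\<lambda>n. of_bool (P n))"

lemma decidable_in_comp: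
  "decidable_in orc P \<Longrightarrow> computable_in orc F \<Longrightarrow> decidable_in orc (\<lambda>n. P (F n))"
  unfolding decidable_in_def by (rule computable_in_comp)

lemma computable_in_of_bool [computable_intros]:
  "decidable_in orc P \<Longrightarrow> computable_in orc (\<lambda>n. of_bool (P n))"
  by (simp add: decidable_in_def)

lemma computable_in_If [computable_intros]:
  assumes "decidable_in orc P" "computable_in orc F" "computable_in orc G"
  shows "computable_in orc (\<lambda>n. if P n then F n else G n)"
proof -
  have F: "computable_in orc (\<lambda>p. F (pfst p))"
    by (rule computable_in_comp [OF assms(2)]) (intro computable_intros)
  have "computable_in orc (\<lambda>n. rec_nat (G n) (\<lambda>_ _. F n) (of_bool (P n)))"
    by (intro computable_intros assms F)
  moreover have "rec_nat (G n) (\<lambda>_ _. F n) (of_bool (P n)) = (if P n then F n else G n)" for n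
    by (cases "P n") auto
  ultimately show ?thesis by simp
qed

lemma decidable_in_const [computable_intros]: "decidable_in orc (\<lambda>_. b)"
  unfolding decidable_in_def by (rule computable_in_const)

lemma decidable_in_not [computable_intros]:
  assumes "decidable_in orc P"
  shows "decidable_in orc (\<lambda>n. \<not> P n)"
proof -
  have "computable_in orc (\<lambda>n. 1 - of_bool (P n))" by (intro computable_intros assms)
  moreover have "1 - of_bool (P n) = (of_bool (\<not> P n) :: nat)" for n by simp
  ultimately show ?thesis unfolding decidable_in_def by simp
qed

lemma decidable_in_conj [computable_intros]:
  assumes "decidable_in orc P" "decidable_in orc Q"
  shows "decidable_in orc (\<lambda>n. P n \<and> Q n)"
proof -
  have "computable_in orc (\<lambda>n. if P n then of_bool (Q n) else 0)" by (intro computable_intros assms)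
  moreover have "(if P n then of_bool (Q n) else 0) = (of_bool (P n \<and> Q n) :: nat)" for n by simp
  ultimately show ?thesis unfolding decidable_in_def by simp
qed

lemma decidable_in_disj [computable_intros]:
  assumes "decidable_in orc P" "decidable_in orc Q"
  shows "decidable_in orc (\<lambda>n. P n \<or> Q n)"
proof -
  have "decidable_in orc (\<lambda>n. \<not> (\<not> P n \<and> \<not> Q n))" by (intro computable_intros assms)
  then show ?thesis by simp
qed

lemma decidable_in_imp [computable_intros]:
  assumes "decidable_in orc P" "decidable_in orc Q"
  shows "decidable_in orc (\<lambda>n. P n \<longrightarrow> Q n)"
proof -
  have "decidable_in orc (\<lambda>n. \<not> P n \<or> Q n)" by (intro computable_intros assms)
  then show ?thesis by (simp only: imp_conv_disj)
qed

lemma decidable_in_le [computable_intros]: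
  assumes "computable_in orc F" "computable_in orc G"
  shows "decidable_in orc (\<lambda>n. F n \<le> G n)"
proof -
  have "computable_in orc (\<lambda>n. 1 - (F n - G n))" by (intro computable_intros assms)
  moreover have "1 - (F n - G n) = of_bool (F n \<le> G n)" for n by simp
  ultimately show ?thesis unfolding decidable_in_def by simp
qed

lemma decidable_in_less [computable_intros]:
  assumes "computable_in orc F" "computable_in orc G"
  shows "decidable_in orc (\<lambda>n. F n < G n)"
  unfolding less_eq_Suc_le by (intro computable_intros assms)

lemma decidable_in_eq [computable_intros]:
  assumes "computable_in orc F" "computable_in orc G"
  shows "decidable_in orc (\<lambda>n. F n = G n)"
proof -
  have "decidable_in orc (\<lambda>n. F n \<le> G n \<and> G n \<le> F n)" by (intro computable_intros assms)
  then show ?thesis by (simp flip: eq_iff)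
qed

lemma decidable_in_All_less [computable_intros]:
  assumes "computable_in orc b" and P: "decidable_in orc (\<lambda>p. P (pfst p) (psnd p))"
  shows "decidable_in orc (\<lambda>n. \<forall>i<b n. P n i)"
proof -
  have P': "decidable_in orc (\<lambda>p. P (pfst p) (pfst (psnd p)))"
    using decidable_in_comp [OF P, of "\<lambda>p. prod_encode (pfst p, pfst (psnd p))"]
    by (simp add: computable_intros)
  have "computable_in orc (\<lambda>n. rec_nat 1 (\<lambda>i v. if P n i then v else 0) (b n))"
    by (intro computable_intros assms P')
  moreover have "rec_nat 1 (\<lambda>i v. if P n i then v else 0) k = (of_bool (\<forall>i<k. P n i) :: nat)" for n k
    by (induction k) (auto simp: less_Suc_eq)
  ultimately show ?thesis unfolding decidable_in_def by simp
qed

lemma decidable_in_Ex_less [computable_intros]: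
  assumes "computable_in orc b" and P: "decidable_in orc (\<lambda>p. P (pfst p) (psnd p))"
  shows "decidable_in orc (\<lambda>n. \<exists>i<b n. P n i)"
proof -
  have "decidable_in orc (\<lambda>n. \<not> (\<forall>i<b n. \<not> P n i))" by (intro computable_intros assms)
  then show ?thesis by simp
qed

text \<open>\<open>Mu\<close> looks for a zero and takes the candidate as first argument; hence the
  negated indicator and the swapped pair. By \<open>ex\<close> the search always terminates.\<close>

lemma computable_in_Least:
  assumes P: "decidable_in orc (\<lambda>p. P (pfst p) (psnd p))" and ex: "\<And>n. \<exists>m. P n m"
  shows "computable_in orc (\<lambda>n. LEAST m. P n m)"
proof -
  have pair: "computable_fun orc 2 (\<lambda>xs. prod_encode (xs ! 1, xs ! 0))"
    unfolding prod_encode_def prod.case by (intro computable_fun_intros) auto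
  have "computable_in orc (\<lambda>p. of_bool (\<not> P (pfst p) (psnd p)))"
    by (intro computable_intros P)
  from computable_fun_comp1 [OF this [unfolded computable_in_iff] pair] obtain c where "\<And>xs. length xs = 2 \<Longrightarrow> evals orc c xs (of_bool (\<not> P (xs ! 1) (xs ! 0)))"
    unfolding computable_fun_def by (auto simp only: pfst_prod_encode psnd_prod_encode)
  from this [of "[_, _]"] have c: "evals orc c [m, n] (of_bool (\<not> P n m))" for m n by simp
  have "evals orc (Mu c) [n] (LEAST m. P n m)" for n
  proof (rule evals.mu)
    show "evals orc c [LEAST m. P n m, n] 0"
      using c [of "LEAST m. P n m" n] LeastI_ex [OF ex [of n]] by simp
    show "\<exists>y>0. evals orc c [m, n] y" if "m < (LEAST m. P n m)" for m
      using c [of m n] not_less_Least [OF that] by (intro exI [of _ 1]) simp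
  qed
  then show ?thesis unfolding computable_in_def by blast
qed

section \<open>Codes of lists\<close>

definition code_length :: "nat \<Rightarrow> nat" where "code_length z = length (list_decode z)"
text \<open>The default \<open>0\<close> past the end will later stand for an unknown value of the
  universal function, all of whose true values are positive.\<close>

definition code_nth :: "nat \<Rightarrow> nat \<Rightarrow> nat" where
  "code_nth z i = (if i < code_length z then list_decode z ! i else 0)"

text \<open>A nonempty list is coded by the successor of a pair. The empty list is its own tail,
  since \<open>psnd 0 = 0\<close>, so tails can be iterated past the end.\<close>

definition code_tl :: "nat \<Rightarrow> nat" where "code_tl z = psnd (z - 1)"

lemma computable_in_code_tl [computable_intros]:
  "computable_in orc F \<Longrightarrow> computable_in orc (\<lambda>n. code_tl (F n))"
  unfolding code_tl_def by (intro computable_intros)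

lemma rec_nat_code_tl:
  "rec_nat z (\<lambda>_ v. code_tl v) i = list_encode (drop i (list_decode z))"
proof (induction i)
  case (Suc i)
  have "code_tl (list_encode ys) = list_encode (tl ys)" for ys by (cases ys) (auto simp: code_tl_def)
  then show ?case using Suc by (simp add: drop_Suc tl_drop)
qed simp

lemma code_nth_eq: "code_nth z i = pfst (rec_nat z (\<lambda>_ v. code_tl v) i - 1)"
proof -
  have "pfst (list_encode ys - 1) = (if ys = [] then 0 else hd ys)" for ys by (cases ys) auto
  from this [of "drop i (list_decode z)"] show ?thesis by (simp add: rec_nat_code_tl code_nth_def code_length_def hd_drop_conv_nth)
qed

lemma computable_in_code_nth [computable_intros]:
  assumes "computable_in orc F" "computable_in orc G"
  shows "computable_in orc (\<lambda>n. code_nth (F n) (G n))"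
  unfolding code_nth_eq by (intro computable_intros assms)

lemma list_encode_eq_0_iff [simp]: "list_encode xs = 0 \<longleftrightarrow> xs = []"
  by (cases xs) auto

lemma code_length_eq: "code_length z = (LEAST i. rec_nat z (\<lambda>_ v. code_tl v) i = 0)"
  by (rule Least_equality [symmetric]) (auto simp: rec_nat_code_tl code_length_def)

lemma computable_in_code_length [computable_intros]:
  assumes "computable_in orc F"
  shows "computable_in orc (\<lambda>n. code_length (F n))"
proof -
  have "computable_in orc (\<lambda>z. LEAST i. rec_nat z (\<lambda>_ v. code_tl v) i = 0)"
    by (rule computable_in_Least)
      (intro computable_intros, auto simp: rec_nat_code_tl intro: exI [of _ "length _"])
  then have "computable_in orc code_length"
    by (subst (asm) code_length_eq [symmetric])
  then show ?thesis using assms by (rule computable_in_comp)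
qed

lemma mem_cylinder_decode:
  "g \<in> cylinder (list_decode z) \<longleftrightarrow> (\<forall>i<code_length z. g i = code_nth z i)"
  by (simp add: cylinder_def code_length_def code_nth_def)

text \<open>This tells in advance how long an initial segment must be to test membership in the
  cylinder coded by a given number.\<close>

lemma code_length_le: "code_length z \<le> z"
proof -
  have "length xs \<le> list_encode xs" for xs
    by (induction xs) (use le_prod_encode_2 le_trans in fastforce)+
  from this [of "list_decode z"] show ?thesis by (simp add: code_length_def)
qed

definition code_prefix :: "nat \<Rightarrow> nat \<Rightarrow> bool" where
  "code_prefix y z \<longleftrightarrow> code_length y \<le> code_length z \<and> (\<forall>i<code_length y. code_nth y i = code_nth z i)"

lemma decidable_in_code_prefix [computable_intros]:
  assumes "computable_in orc F" "computable_in orc G"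
  shows "decidable_in orc (\<lambda>n. code_prefix (F n) (G n))"
proof -
  have "computable_in orc (\<lambda>n. F (pfst n))" "computable_in orc (\<lambda>n. G (pfst n))"
    by (intro computable_in_comp [OF assms(1)] computable_in_comp [OF assms(2)] computable_intros)+
  then show ?thesis unfolding code_prefix_def by (intro computable_intros assms)
qed

lemma code_prefix_cylinder:
  "code_prefix y z \<Longrightarrow> g \<in> cylinder (list_decode z) \<Longrightarrow> g \<in> cylinder (list_decode y)"
  by (simp add: code_prefix_def mem_cylinder_decode)

lemma code_prefix_iff_cylinder:
  "g \<in> cylinder (list_decode z) \<Longrightarrow> code_length y \<le> code_length z \<Longrightarrow>
    code_prefix y z \<longleftrightarrow> g \<in> cylinder (list_decode y)"
  by (auto simp add: code_prefix_def mem_cylinder_decode)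

definition code_restrict :: "(nat \<Rightarrow> nat) \<Rightarrow> nat \<Rightarrow> nat" where
  "code_restrict g n = list_encode (map g [0..<n])"

lemma code_length_restrict [simp]: "code_length (code_restrict g n) = n"
  by (simp add: code_length_def code_restrict_def)

lemma code_nth_restrict: "code_nth (code_restrict g n) i = (if i < n then g i else 0)"
  by (simp add: code_nth_def code_length_def code_restrict_def)

lemma mem_cylinder_restrict [simp]: "g \<in> cylinder (list_decode (code_restrict g n))"
  by (simp add: mem_cylinder_decode code_nth_restrict)

lemma mem_cylinder_iff_restrict:
  "g \<in> cylinder (list_decode z) \<longleftrightarrow> z = code_restrict g (code_length z)"
proof
  assume "g \<in> cylinder (list_decode z)"
  then have "list_decode z = map g [0..<code_length z]"
    by (intro nth_equalityI) (auto simp: cylinder_def code_length_def)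
  then show "z = code_restrict g (code_length z)"
    by (metis code_restrict_def list_decode_inverse)
qed (metis mem_cylinder_restrict)

section \<open>Effectively open sets\<close>

text \<open>The projection form treats the empty set uniformly and reduces closure properties to
  decidable predicates. An enumeration \<open>h\<close> supplies the witness \<open>n\<close> for
  \<open>h n\<close>; conversely, a fixed element of \<open>W\<close> fills the places where
  \<open>P\<close> fails.\<close>

lemma computably_enumerable_iff:
  "computably_enumerable W \<longleftrightarrow> (\<exists>P. decidable_in Map.empty P \<and> W = pfst ` {s. P s})"
proof
  assume "computably_enumerable W"
  then consider "W = {}" | h where "computable h" "W = range h"
    unfolding computably_enumerable_def by blast
  then show "\<exists>P. decidable_in Map.empty P \<and> W = pfst ` {s. P s}"
  proof cases
    case 1
    then show ?thesis by (intro exI [of _ "\<lambda>_. False"]) (auto intro: computable_intros)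
  next
    case 2
    have "computable_in Map.empty (\<lambda>s. h (psnd s))"
      using 2(1) unfolding computable_iff by (rule computable_in_comp) (intro computable_intros)
    then have "decidable_in Map.empty (\<lambda>s. pfst s = h (psnd s))" by (intro computable_intros)
    moreover have "W = pfst ` {s. pfst s = h (psnd s)}"
    proof -
      have "h n \<in> pfst ` {s. pfst s = h (psnd s)}" for n
        by (rule image_eqI [of _ _ "prod_encode (h n, n)"]) auto
      then show ?thesis using 2(2) by auto
    qed
    ultimately show ?thesis by blast
  qed
next
  assume "\<exists>P. decidable_in Map.empty P \<and> W = pfst ` {s. P s}"
  then obtain P where P: "decidable_in Map.empty P" "W = pfst ` {s. P s}" by blast
  show "computably_enumerable W"
  proof (cases "\<exists>s. P s")
    case True
    then obtain s0 where "P s0" ..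
    then have "W = range (\<lambda>s. if P s then pfst s else pfst s0)" using P(2) by auto
    moreover have "computable (\<lambda>s. if P s then pfst s else pfst s0)"
      unfolding computable_iff by (intro computable_intros P)
    ultimately show ?thesis unfolding computably_enumerable_def by blast
  qed (use P in \<open>simp add: computably_enumerable_def\<close>)
qed

text \<open>\<open>s\<close> codes a pair whose first component codes a basic open set; its second component is a witness
  for the enumeration of this set.\<close>

definition hits :: "(nat \<Rightarrow> 'x set) \<Rightarrow> (nat \<Rightarrow> bool) \<Rightarrow> (nat \<Rightarrow> nat) \<Rightarrow> 'x \<Rightarrow> nat \<Rightarrow> bool" where
  "hits B P g x s \<longleftrightarrow> P s \<and> g \<in> cylinder (list_decode (pfst (pfst s))) \<and> x \<in> B (psnd (pfst s))"

lemma Sigma01_iff: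
  "Sigma01 B S \<longleftrightarrow> (\<exists>P. decidable_in Map.empty P \<and> S = {(g, x). \<exists>s. hits B P g x s})"
proof -
  have eq: "\<Union> {cylinder \<sigma> \<times> B j | \<sigma> j. prod_encode (list_encode \<sigma>, j) \<in> pfst ` {s. P s}}
      = {(g, x). \<exists>s. hits B P g x s}" (is "?L = ?R") for P
  proof (intro equalityI subsetI)
    fix y assume "y \<in> ?L"
    then obtain \<sigma> j s where "y \<in> cylinder \<sigma> \<times> B j" "P s" "prod_encode (list_encode \<sigma>, j) = pfst s"
      by auto
    moreover from this(3) have "list_decode (pfst (pfst s)) = \<sigma>" "psnd (pfst s) = j"
      by (metis pfst_prod_encode list_encode_inverse, metis psnd_prod_encode)
    ultimately show "y \<in> ?R" unfolding hits_def by auto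
  next
    fix y assume "y \<in> ?R"
    then obtain s where s: "P s" "y \<in> cylinder (list_decode (pfst (pfst s))) \<times> B (psnd (pfst s))"
      unfolding hits_def by auto
    moreover have "prod_encode (list_encode (list_decode (pfst (pfst s))), psnd (pfst s)) = pfst s"
      by simp
    ultimately show "y \<in> ?L" by blast
  qed
  show ?thesis unfolding Sigma01_def computably_enumerable_iff eq [symmetric] by blast
qed

lemma Sigma01_Un:
  assumes "Sigma01 B S" "Sigma01 B T"
  shows "Sigma01 B (S \<union> T)"
proof -
  obtain P R where P: "decidable_in Map.empty P" "S = {(g, x). \<exists>s. hits B P g x s}"
    and R: "decidable_in Map.empty R" "T = {(g, x). \<exists>s. hits B R g x s}"
    using assms unfolding Sigma01_iff by blast
  have "decidable_in Map.empty (\<lambda>s. P s \<or> R s)" by (intro computable_intros P R)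
  moreover have "S \<union> T = {(g, x). \<exists>s. hits B (\<lambda>s. P s \<or> R s) g x s}"
    unfolding P R hits_def by auto
  ultimately show ?thesis unfolding Sigma01_iff by blast
qed

section \<open>Reduction of effectively open sets\<close>

definition code_hits :: "(nat \<Rightarrow> bool) \<Rightarrow> nat \<Rightarrow> nat \<Rightarrow> nat \<Rightarrow> bool" where
  "code_hits P y z s \<longleftrightarrow> P s \<and> code_prefix (pfst (pfst s)) y \<and> code_prefix (psnd (pfst s)) z"

text \<open>The stage \<open>s\<close> bounds the codes of both sequences that it names, hence their
  lengths, so initial segments of length \<open>s\<close> decide the hit.\<close>

lemma code_hits_iff:
  assumes "g \<in> cylinder (list_decode y)" "x \<in> cylinder (list_decode z)"
    and "s \<le> code_length y" "s \<le> code_length z"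
  shows "code_hits P y z s \<longleftrightarrow> hits baire_basis P g x s"
proof -
  have "code_length (pfst (pfst s)) \<le> s" "code_length (psnd (pfst s)) \<le> s"
    by (meson code_length_le pfst_le psnd_le le_trans)+
  then show ?thesis
    using assms code_prefix_iff_cylinder unfolding code_hits_def hits_def baire_basis_def
    by (meson le_trans)
qed

text \<open>Absence of hits is not an open condition in general, but below the bound
  \<open>b s\<close> only finitely many stages matter, and long enough initial segments of
  \<open>g\<close> and \<open>x\<close> decide them all.\<close>

lemma Sigma01_hits_before:
  assumes P: "decidable_in Map.empty P" and R: "decidable_in Map.empty R"
    and b: "computable_in Map.empty b"
  shows "Sigma01 baire_basis
    {(g, x). \<exists>s. hits baire_basis P g x s \<and> (\<forall>r<b s. \<not> hits baire_basis R g x r)}"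
proof -
  \<comment> \<open>\<open>t\<close> names a box given by \<open>y\<close> and \<open>z\<close>, and
    a stage \<open>s\<close>; the four length conditions make the test on codes agree with the true
    hits at \<open>s\<close> and at all stages below \<open>b s\<close>.\<close>
  define T where "T t \<longleftrightarrow> (let y = pfst (pfst t); z = psnd (pfst t); s = psnd t in
    s \<le> code_length y \<and> s \<le> code_length z \<and> b s \<le> code_length y \<and> b s \<le> code_length z \<and>
    code_hits P y z s \<and> (\<forall>r<b s. \<not> code_hits R y z r))" for t
  have "decidable_in Map.empty T"
    unfolding T_def Let_def code_hits_def
    by (intro computable_intros computable_in_comp [OF b] decidable_in_comp [OF P] decidable_in_comp [OF R])
  moreover have "(\<exists>s. hits baire_basis P g x s \<and> (\<forall>r<b s. \<not> hits baire_basis R g x r))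
      \<longleftrightarrow> (\<exists>t. hits baire_basis T g x t)" for g x
  proof
    assume "\<exists>s. hits baire_basis P g x s \<and> (\<forall>r<b s. \<not> hits baire_basis R g x r)"
    then obtain s where s: "hits baire_basis P g x s" "\<forall>r<b s. \<not> hits baire_basis R g x r" by blast
    let ?n = "s + b s"
    have "code_hits P (code_restrict g ?n) (code_restrict x ?n) s"
      using s(1) by (subst code_hits_iff [of g _ x]) auto
    moreover have "\<not> code_hits R (code_restrict g ?n) (code_restrict x ?n) r" if "r < b s" for r
      using s(2) that by (subst code_hits_iff [of g _ x]) auto
    ultimately have "hits baire_basis T g x
        (prod_encode (prod_encode (code_restrict g ?n, code_restrict x ?n), s))"
      by (simp add: hits_def T_def baire_basis_def)
    then show "\<exists>t. hits baire_basis T g x t" ..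
  next
    assume "\<exists>t. hits baire_basis T g x t"
    then obtain t where t: "hits baire_basis T g x t" ..
    define y z s where yzs: "y = pfst (pfst t)" "z = psnd (pfst t)" "s = psnd t"
    have mem: "g \<in> cylinder (list_decode y)" "x \<in> cylinder (list_decode z)"
      using t by (auto simp: hits_def baire_basis_def yzs)
    have T: "s \<le> code_length y" "s \<le> code_length z" "b s \<le> code_length y" "b s \<le> code_length z"
      "code_hits P y z s" "\<forall>r<b s. \<not> code_hits R y z r"
      using t by (auto simp: hits_def T_def yzs Let_def)
    have "hits baire_basis P g x s" using T code_hits_iff [OF mem] by blast
    moreover have "\<not> hits baire_basis R g x r" if "r < b s" for r
    proof -
      have "r \<le> code_length y" "r \<le> code_length z" using that T by linarith+
      then show ?thesis using T(6) that code_hits_iff [OF mem] by blast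
    qed
    ultimately show "\<exists>s. hits baire_basis P g x s \<and> (\<forall>r<b s. \<not> hits baire_basis R g x r)" by blast
  qed
  ultimately show ?thesis unfolding Sigma01_iff by auto
qed

text \<open>A point is assigned to the set that it enters first, with ties going to
  \<open>S\<close>. Since every point enters one of them, the two outcomes are complementary, and
  each is effectively open.\<close>

lemma Sigma01_reduction:
  assumes "Sigma01 baire_basis S" "Sigma01 baire_basis T" "S \<union> T = UNIV"
  obtains Q where "Delta01 baire_basis Q" "Q \<subseteq> S" "- Q \<subseteq> T"
proof -
  obtain P R where P: "decidable_in Map.empty P" "S = {(g, x). \<exists>s. hits baire_basis P g x s}"
    and R: "decidable_in Map.empty R" "T = {(g, x). \<exists>s. hits baire_basis R g x s}"
    using assms unfolding Sigma01_iff by blast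
  define Q where "Q = {(g, x). \<exists>s. hits baire_basis P g x s \<and> (\<forall>r<s. \<not> hits baire_basis R g x r)}"
  have "(\<exists>s. p s \<and> (\<forall>r<s. \<not> q r)) \<longleftrightarrow> \<not> (\<exists>s. q s \<and> (\<forall>r<Suc s. \<not> p r))"
    if ex: "\<exists>s. p s \<or> q s" for p q :: "nat \<Rightarrow> bool"
  proof -
    obtain s where "p s \<or> q s" "\<forall>r<s. \<not> p r \<and> \<not> q r"
      using iffD1 [OF exists_least_iff ex] by blast
    then show ?thesis by (metis less_Suc_eq linorder_neqE_nat)
  qed
  moreover have "\<exists>s. hits baire_basis P g x s \<or> hits baire_basis R g x s" for g x
    using assms(3) unfolding P R by blast
  \<comment> \<open>The bound \<open>Suc s\<close> excludes simultaneous entry, since ties belong to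
    \<open>Q\<close>.\<close>
  ultimately have "- Q = {(g, x). \<exists>s. hits baire_basis R g x s \<and> (\<forall>r<Suc s. \<not> hits baire_basis P g x r)}"
    unfolding Q_def by auto
  then have "Delta01 baire_basis Q"
    unfolding Delta01_def Q_def
    by (auto intro!: Sigma01_hits_before [OF P(1) R(1)] Sigma01_hits_before [OF R(1) P(1)] computable_intros)
  moreover have "Q \<subseteq> S" unfolding Q_def P by auto
  moreover have "- Q \<subseteq> T" unfolding \<open>- Q = _\<close> R by auto
  ultimately show ?thesis by (rule that)
qed

lemma strongly_relativizes_if_singleton:
  assumes "Sigma01 baire_basis ((- {f}) \<times> UNIV)"
  shows "strongly_relativizes_Delta01 baire_basis f"
  unfolding strongly_relativizes_Delta01_def
proof (intro allI impI)
  fix P assume "Delta01_in baire_basis f P"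
  then obtain U V where U: "Sigma01 baire_basis U" "P = sect U f"
    and V: "Sigma01 baire_basis V" "- P = sect V f"
    unfolding Delta01_in_def by blast
  let ?N = "(- {f}) \<times> (UNIV :: (nat \<Rightarrow> nat) set)"
  have "(U \<union> ?N) \<union> (V \<union> ?N) = UNIV"
  proof (intro equalityI subsetI)
    fix y assume "y \<in> (UNIV :: ((nat \<Rightarrow> nat) \<times> (nat \<Rightarrow> nat)) set)"
    show "y \<in> (U \<union> ?N) \<union> (V \<union> ?N)"
      using U(2) V(2) unfolding sect_def by (cases y) auto
  qed auto
  then obtain Q where Q: "Delta01 baire_basis Q" "Q \<subseteq> U \<union> ?N" "- Q \<subseteq> V \<union> ?N"
    using Sigma01_reduction [OF Sigma01_Un [OF U(1) assms] Sigma01_Un [OF V(1) assms]] by blast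
  have "P = sect Q f"
    using Q(2,3) U(2) V(2) unfolding sect_def by blast
  with Q(1) show "\<exists>Q. Delta01 baire_basis Q \<and> P = sect Q f" by blast
qed

section \<open>Transfer from Baire space to the natural numbers\<close>

lemma Sigma01_head:
  assumes "Sigma01 nat_basis S"
  shows "Sigma01 baire_basis {(g, x). (g, x 0) \<in> S}"
proof -
  obtain P where P: "decidable_in Map.empty P" "S = {(g, n). \<exists>s. hits nat_basis P g n s}"
    using assms unfolding Sigma01_iff by blast
  define T where "T t \<longleftrightarrow> P (psnd t) \<and> pfst (pfst t) = pfst (pfst (psnd t)) \<and>
    0 < code_length (psnd (pfst t)) \<and> code_nth (psnd (pfst t)) 0 = psnd (pfst (psnd t))" for t
  have "decidable_in Map.empty T"
    unfolding T_def by (intro computable_intros decidable_in_comp [OF P(1)])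
  moreover have "(\<exists>s. hits nat_basis P g (x 0) s) \<longleftrightarrow> (\<exists>t. hits baire_basis T g x t)" for g x
  proof
    assume "\<exists>s. hits nat_basis P g (x 0) s"
    then obtain s where "hits nat_basis P g (x 0) s" ..
    then have "hits baire_basis T g x (prod_encode (prod_encode (pfst (pfst s), code_restrict x 1), s))"
      by (simp add: hits_def T_def nat_basis_def baire_basis_def code_nth_restrict)
    then show "\<exists>t. hits baire_basis T g x t" ..
  next
    assume "\<exists>t. hits baire_basis T g x t"
    then obtain t where "hits baire_basis T g x t" ..
    then have "hits nat_basis P g (x 0) (psnd t)"
      by (auto simp: hits_def T_def nat_basis_def baire_basis_def mem_cylinder_decode)
    then show "\<exists>s. hits nat_basis P g (x 0) s" ..
  qed
  ultimately show ?thesis unfolding Sigma01_iff P by auto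
qed

lemma Sigma01_constant:
  assumes "Sigma01 baire_basis S"
  shows "Sigma01 nat_basis {(g, n). (g, \<lambda>_. n) \<in> S}"
proof -
  obtain P where P: "decidable_in Map.empty P" "S = {(g, n). \<exists>s. hits baire_basis P g n s}"
    using assms unfolding Sigma01_iff by blast
  define T where "T t \<longleftrightarrow> P (psnd t) \<and> pfst (pfst t) = pfst (pfst (psnd t)) \<and>
    (\<forall>i<code_length (psnd (pfst (psnd t))). psnd (pfst t) = code_nth (psnd (pfst (psnd t))) i)" for t
  have "decidable_in Map.empty T"
    unfolding T_def by (intro computable_intros decidable_in_comp [OF P(1)])
  moreover have "(\<exists>s. hits baire_basis P g (\<lambda>_. n) s) \<longleftrightarrow> (\<exists>t. hits nat_basis T g n t)" for g n
  proof
    assume "\<exists>s. hits baire_basis P g (\<lambda>_. n) s"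
    then obtain s where "hits baire_basis P g (\<lambda>_. n) s" ..
    then have "hits nat_basis T g n (prod_encode (prod_encode (pfst (pfst s), n), s))"
      by (simp add: hits_def T_def nat_basis_def baire_basis_def mem_cylinder_decode)
    then show "\<exists>t. hits nat_basis T g n t" ..
  next
    assume "\<exists>t. hits nat_basis T g n t"
    then obtain t where "hits nat_basis T g n t" ..
    then have "hits baire_basis P g (\<lambda>_. n) (psnd t)"
      by (auto simp: hits_def T_def nat_basis_def baire_basis_def mem_cylinder_decode)
    then show "\<exists>s. hits baire_basis P g (\<lambda>_. n) s" ..
  qed
  ultimately show ?thesis unfolding Sigma01_iff P by auto
qed

text \<open>The maps taking \<open>n\<close> to a constant sequence and \<open>x\<close> to
  \<open>x 0\<close> make the natural numbers an effective retract of Baire space. The set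
  \<open>P\<close> is pulled back along the second map, and the resulting \<open>Q\<close> along the
  first.\<close>

lemma strongly_relativizes_nat_if_baire:
  assumes "strongly_relativizes_Delta01 baire_basis f"
  shows "strongly_relativizes_Delta01 nat_basis f"
  unfolding strongly_relativizes_Delta01_def
proof (intro allI impI)
  fix P assume "Delta01_in nat_basis f P"
  then obtain U V where UV: "Sigma01 nat_basis U" "P = sect U f" "Sigma01 nat_basis V" "- P = sect V f"
    unfolding Delta01_in_def by blast
  have "Delta01_in baire_basis f {x. x 0 \<in> P}"
    unfolding Delta01_in_def
  proof (intro exI conjI)
    show "Sigma01 baire_basis {(g, x). (g, x 0) \<in> U}" "Sigma01 baire_basis {(g, x). (g, x 0) \<in> V}"
      using UV by (auto intro: Sigma01_head)
    show "{x. x 0 \<in> P} = sect {(g, x). (g, x 0) \<in> U} f" using UV by (auto simp: sect_def)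
    show "- {x. x 0 \<in> P} = sect {(g, x). (g, x 0) \<in> V} f" using UV by (auto simp: sect_def)
  qed
  then obtain Q where Q: "Delta01 baire_basis Q" "{x. x 0 \<in> P} = sect Q f"
    using assms unfolding strongly_relativizes_Delta01_def by blast
  let ?Q = "{(g, n). (g, \<lambda>_. n) \<in> Q}"
  have "- ?Q = {(g, n). (g, \<lambda>_. n) \<in> - Q}" by auto
  then have "Delta01 nat_basis ?Q"
    using Q(1) Sigma01_constant unfolding Delta01_def by metis
  moreover have "P = sect ?Q f"
  proof -
    have "n \<in> P \<longleftrightarrow> (f, \<lambda>_. n) \<in> Q" for n
      using Q(2) unfolding sect_def by (auto simp: set_eq_iff dest: spec [of _ "\<lambda>_. n"])
    then show ?thesis by (auto simp: sect_def)
  qed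
  ultimately show "\<exists>Q. Delta01 nat_basis Q \<and> P = sect Q f" by blast
qed

section \<open>A universal partial function as an effectively closed singleton\<close>

text \<open>Predecessor is included because list codes are successors of pairs and must be
  unpacked.\<close>

definition base_fun :: "nat \<Rightarrow> nat \<Rightarrow> nat" where
  "base_fun a x = (if a = 0 then 0 else if a = 1 then Suc x else if a = 2 then x - 1
    else if a = 3 then pfst x else psnd x)"

abbreviation left_arg :: "nat \<Rightarrow> nat" where "left_arg e \<equiv> pfst (psnd e)"
abbreviation right_arg :: "nat \<Rightarrow> nat" where "right_arg e \<equiv> psnd (psnd e)"

text \<open>Unary codes \<open>(tag, (a, b))\<close> for pairing, composition, primitive recursion and minimization.
  The result \<open>1\<close> means divergence, and \<open>y + 2\<close> means convergence to \<open>y\<close>.\<close>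

function univ :: "nat \<Rightarrow> nat \<Rightarrow> nat" where
  "univ e x =
    (if pfst e = 0 then base_fun (left_arg e) x + 2
     else if pfst e = 1 then
       (if univ (left_arg e) x = 1 \<or> univ (right_arg e) x = 1 then 1
        else prod_encode (univ (left_arg e) x - 2, univ (right_arg e) x - 2) + 2)
     else if pfst e = 2 then
       (if univ (right_arg e) x = 1 then 1 else univ (left_arg e) (univ (right_arg e) x - 2))
     else if pfst e = 3 then
       rec_nat (univ (left_arg e) (psnd x))
         (\<lambda>n v. if v = 1 then 1
           else univ (right_arg e) (prod_encode (prod_encode (n, v - 2), psnd x))) (pfst x)
     else if \<exists>n. univ (left_arg e) (prod_encode (n, x)) = 2 \<and>
         (\<forall>m<n. univ (left_arg e) (prod_encode (m, x)) > 2)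
       then (LEAST n. univ (left_arg e) (prod_encode (n, x)) = 2 \<and>
         (\<forall>m<n. univ (left_arg e) (prod_encode (m, x)) > 2)) + 2
     else 1)"
  by auto

text \<open>These inequalities justify recursion on the program alone: arguments may grow, since
  primitive recursion is delegated to \<open>rec_nat\<close> and the halting of minimizations to an
  unbounded quantifier.\<close>

lemma arg_less:
  assumes "pfst e \<noteq> 0"
  shows "left_arg e < e" "right_arg e < e"
proof -
  have "psnd e < prod_encode (pfst e, psnd e)"
    using assms le_prod_encode_2 [of "psnd e" "pfst e - 1"]
    by (cases "pfst e") (simp_all add: prod_encode_def)
  then show "left_arg e < e" "right_arg e < e"
    using pfst_le [of "psnd e"] psnd_le [of "psnd e"] by simp_all
qed

termination
  by (relation "measure fst") (auto intro: arg_less)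

declare univ.simps [simp del]

definition universal :: "nat \<Rightarrow> nat" where "universal k = univ (pfst k) (psnd k)"

lemma universal_prod_encode [simp]: "universal (prod_encode (e, x)) = univ e x"
  by (simp add: universal_def)

lemma univ_pos: "univ e x > 0"
proof (induction e arbitrary: x rule: less_induct)
  case (less e)
  note IH = less.IH [OF arg_less(1)] less.IH [OF arg_less(2)]
  have "rec_nat (univ (left_arg e) (psnd x)) (\<lambda>n v. if v = 1 then 1
      else univ (right_arg e) (prod_encode (prod_encode (n, v - 2), psnd x))) n > 0"
    if "pfst e \<noteq> 0" for n
    by (cases n) (auto simp: IH that)
  then show ?case by (subst univ.simps) (simp add: IH)
qed

section \<open>Local conditions that characterize the universal function\<close>

definition mu_hit :: "(nat \<Rightarrow> nat) \<Rightarrow> nat \<Rightarrow> nat \<Rightarrow> nat \<Rightarrow> bool" where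
  "mu_hit G a x n \<longleftrightarrow> G (prod_encode (a, prod_encode (n, x))) = 2 \<and>
    (\<forall>m<n. G (prod_encode (a, prod_encode (m, x))) > 2)"

text \<open>The value at \<open>(e, x)\<close> forced by the values of \<open>G\<close> at other places, for all codes except those of
  minimizations. The value \<open>0\<close> means that it is not known yet.\<close>

definition expected :: "(nat \<Rightarrow> nat) \<Rightarrow> nat \<Rightarrow> nat \<Rightarrow> nat" where
  "expected G e x =
    (if pfst e = 0 then base_fun (left_arg e) x + 2
     else if pfst e = 1 then
       (let u = G (prod_encode (left_arg e, x)); v = G (prod_encode (right_arg e, x))
        in if u = 0 \<or> v = 0 then 0 else if u = 1 \<or> v = 1 then 1 else prod_encode (u - 2, v - 2) + 2)
     else if pfst e = 2 then
       (let v = G (prod_encode (right_arg e, x))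
        in if v \<le> 1 then v else G (prod_encode (left_arg e, v - 2)))
     else if pfst x = 0 then G (prod_encode (left_arg e, psnd x))
     else
       (let v = G (prod_encode (e, prod_encode (pfst x - 1, psnd x)))
        in if v \<le> 1 then v
          else G (prod_encode (right_arg e, prod_encode (prod_encode (pfst x - 1, v - 2), psnd x)))))"

text \<open>A contradiction must be visible from known, that is nonzero, values, so that further
  information cannot remove it. For minimizations, where \<open>2\<close> encodes output zero,
  divergence is refuted by a hit \<open>n\<close>, and output \<open>c - 2\<close> by a known wrong
  value there or by divergence or a zero before it.\<close>

definition inconsistent :: "(nat \<Rightarrow> nat) \<Rightarrow> nat \<Rightarrow> nat \<Rightarrow> nat \<Rightarrow> bool" where
  "inconsistent G e x n \<longleftrightarrow>
    (let c = G (prod_encode (e, x)); a = left_arg e in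
     if pfst e \<le> 3 then c \<noteq> 0 \<and> expected G e x \<noteq> 0 \<and> c \<noteq> expected G e x
     else c = 1 \<and> mu_hit G a x n \<or>
       c \<ge> 2 \<and> (G (prod_encode (a, prod_encode (c - 2, x))) \<notin> {0, 2} \<or>
         (\<exists>m<c - 2. G (prod_encode (a, prod_encode (m, x))) \<in> {1, 2})))"

text \<open>Primitive recursion is unrolled by one step only: the value at a successor refers to the
  same program at its predecessor.\<close>

lemma univ_eq_expected:
  assumes "pfst e \<le> 3"
  shows "univ e x = expected universal e x"
proof -
  consider "pfst e = 0" | "pfst e = 1" | "pfst e = 2" | "pfst e = 3" using assms by linarith
  then show ?thesis
  proof cases
    case 4
    show ?thesis
    proof (cases "pfst x")
      case (Suc n)
      have "univ e (prod_encode (n, psnd x)) = rec_nat (univ (left_arg e) (psnd x))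
         (\<lambda>n v. if v = 1 then 1
           else univ (right_arg e) (prod_encode (prod_encode (n, v - 2), psnd x))) n"
        using 4 by (subst univ.simps) (simp cong: if_cong)
      moreover have "v \<le> 1 \<longleftrightarrow> v = 1" if "v > 0" for v :: nat using that by auto
      ultimately show ?thesis
        using 4 Suc univ_pos [of e "prod_encode (n, psnd x)"]
        by (subst univ.simps) (simp add: expected_def Let_def)
    qed (use 4 in \<open>subst univ.simps, simp add: expected_def\<close>)
  next
    case 3
    moreover have "v \<le> 1 \<longleftrightarrow> v = 1" if "v > 0" for v :: nat using that by auto
    ultimately show ?thesis
      using univ_pos [of "right_arg e" x] by (subst univ.simps) (auto simp add: expected_def Let_def)
  next
    case 2
    then show ?thesis
      using univ_pos [of "right_arg e" x] univ_pos [of "left_arg e" x]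
      by (subst univ.simps) (simp add: expected_def Let_def)
  qed (subst univ.simps, simp add: expected_def)
qed

lemma univ_mu:
  assumes "\<not> pfst e \<le> 3"
  shows "univ e x = (if \<exists>n. mu_hit universal (left_arg e) x n
    then (LEAST n. mu_hit universal (left_arg e) x n) + 2 else 1)"
proof -
  have "mu_hit universal (left_arg e) x = (\<lambda>n. univ (left_arg e) (prod_encode (n, x)) = 2 \<and>
      (\<forall>m<n. univ (left_arg e) (prod_encode (m, x)) > 2))"
    by (rule ext) (simp add: mu_hit_def)
  then show ?thesis using assms by (subst univ.simps) simp
qed

lemma mu_hit_unique: "mu_hit G a x n \<Longrightarrow> mu_hit G a x m \<Longrightarrow> n = m"
  unfolding mu_hit_def by (metis linorder_neqE_nat less_irrefl)

lemma univ_mu_eq: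
  assumes "\<not> pfst e \<le> 3" "mu_hit universal (left_arg e) x n"
  shows "univ e x = n + 2"
proof -
  have "(LEAST n. mu_hit universal (left_arg e) x n) = n"
    using mu_hit_unique [OF assms(2)] assms(2) by (metis LeastI)
  then show ?thesis using assms by (auto simp: univ_mu)
qed

text \<open>Unknown inputs propagate to an unknown result, so a nonzero result used only nonzero
  entries, on which \<open>H\<close> agrees with \<open>G\<close>.\<close>

lemma expected_mono:
  assumes "\<And>i. G i \<noteq> 0 \<Longrightarrow> G i = H i" "expected G e x \<noteq> 0"
  shows "expected G e x = expected H e x"
proof -
  have eq: "G i = 0 \<or> G i = H i" for i using assms(1) by blast
  let ?p = "prod_encode (e, prod_encode (pfst x - 1, psnd x))"
  consider "pfst e = 0" | "pfst e = 1" | "pfst e = 2"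
    | "pfst e \<noteq> 0" "pfst e \<noteq> 1" "pfst e \<noteq> 2" by blast
  then show ?thesis
  proof cases
    case 2
    then show ?thesis
      using assms(2) eq [of "prod_encode (left_arg e, x)"] eq [of "prod_encode (right_arg e, x)"]
      by (auto simp: expected_def Let_def split: if_splits)
  next
    case 3
    then show ?thesis
      using assms(2) eq [of "prod_encode (right_arg e, x)"]
        eq [of "prod_encode (left_arg e, G (prod_encode (right_arg e, x)) - 2)"]
      by (auto simp: expected_def Let_def split: if_splits)
  next
    case 4
    then show ?thesis
      using assms(2) eq [of "prod_encode (left_arg e, psnd x)"] eq [of ?p]
        eq [of "prod_encode (right_arg e, prod_encode (prod_encode (pfst x - 1, G ?p - 2), psnd x))"]
      by (auto simp: expected_def Let_def split: if_splits)
  qed (simp add: expected_def)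
qed

text \<open>Soundness: correct partial information is never refuted. For a minimization with value
  at least \<open>2\<close>, the unique hit is at that value minus \<open>2\<close>, which excludes
  the listed conflicts.\<close>

lemma not_inconsistent_universal:
  assumes G: "\<And>i. G i \<noteq> 0 \<Longrightarrow> G i = universal i"
  shows "\<not> inconsistent G e x n"
proof
  assume inc: "inconsistent G e x n"
  show False
  proof (cases "pfst e \<le> 3")
    case True
    then have "G (prod_encode (e, x)) \<noteq> 0" "expected G e x \<noteq> 0" "G (prod_encode (e, x)) \<noteq> expected G e x"
      using inc by (simp_all add: inconsistent_def Let_def)
    then show False
      using G [of "prod_encode (e, x)"] expected_mono [of G universal e x, OF G] univ_eq_expected [OF True] by simp
  next
    case False
    let ?c = "G (prod_encode (e, x))" and ?a = "left_arg e"
    have hit: "mu_hit universal ?a x m" if "mu_hit G ?a x m" for m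
      using that unfolding mu_hit_def by (metis G not_less0 zero_neq_numeral)
    from inc False consider "?c = 1" "mu_hit G ?a x n"
      | "?c \<ge> 2" "G (prod_encode (?a, prod_encode (?c - 2, x))) \<notin> {0, 2}"
      | m where "?c \<ge> 2" "m < ?c - 2" "G (prod_encode (?a, prod_encode (m, x))) \<in> {1, 2}"
      by (auto simp: inconsistent_def Let_def)
    then show False
    proof cases
      case 1
      then show False using univ_mu_eq [OF False hit] G [of "prod_encode (e, x)"] by simp
    next
      case 2
      then have c: "univ e x = ?c" "univ e x \<ge> 2" using G [of "prod_encode (e, x)"] by auto
      then obtain k where k: "mu_hit universal ?a x k"
        using univ_mu [OF False, of x] by (auto split: if_splits)
      then have "k = ?c - 2" using univ_mu_eq [OF False k] c by simp
      then show False
        using k 2 G [of "prod_encode (?a, prod_encode (k, x))"] by (auto simp: mu_hit_def)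
    next
      case 3
      then have c: "univ e x = ?c" "univ e x \<ge> 2" using G [of "prod_encode (e, x)"] by auto
      then obtain k where k: "mu_hit universal ?a x k"
        using univ_mu [OF False, of x] by (auto split: if_splits)
      then have "k = ?c - 2" using univ_mu_eq [OF False k] c by simp
      then have "univ ?a (prod_encode (m, x)) > 2" using k 3 by (auto simp: mu_hit_def)
      then show False using 3 G [of "prod_encode (?a, prod_encode (m, x))"] by auto
    qed
  qed
qed

definition truncate :: "(nat \<Rightarrow> nat) \<Rightarrow> nat \<Rightarrow> nat \<Rightarrow> nat" where
  "truncate g N i = (if i < N then g i else 0)"

text \<open>The value depends on finitely many places, some of them determined by earlier answers;
  beyond their maximum, truncation has no effect.\<close>

lemma expected_truncate: "\<exists>N. \<forall>M\<ge>N. expected (truncate g M) e x = expected g e x"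
proof -
  let ?I = "{prod_encode (left_arg e, x), prod_encode (right_arg e, x),
    prod_encode (left_arg e, g (prod_encode (right_arg e, x)) - 2),
    prod_encode (left_arg e, psnd x), prod_encode (e, prod_encode (pfst x - 1, psnd x)),
    prod_encode (right_arg e, prod_encode (prod_encode (pfst x - 1,
      g (prod_encode (e, prod_encode (pfst x - 1, psnd x))) - 2), psnd x))}"
  obtain N where N: "i < N" if "i \<in> ?I" for i
    using finite_nat_set_iff_bounded [of ?I] by auto
  have "expected (truncate g M) e x = expected g e x" if "M \<ge> N" for M
  proof -
    have "\<forall>i\<in>?I. truncate g M i = g i"
      using N that by (auto simp: truncate_def intro: less_le_trans)
    then show ?thesis unfolding expected_def Let_def by (simp cong: if_cong)
  qed
  then show ?thesis by blast
qed

text \<open>Completeness: by induction on programs, the local conditions force every value.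
  Positivity of \<open>g\<close> ensures that every entry becomes known in long enough
  truncations.\<close>

lemma consistent_eq_universal:
  assumes pos: "\<And>i. g i > 0" and con: "\<And>N e x n. \<not> inconsistent (truncate g N) e x n"
  shows "g = universal"
proof -
  have exp: "g (prod_encode (e, x)) = expected g e x" if "pfst e \<le> 3" "expected g e x \<noteq> 0" for e x
  proof -
    obtain N where "\<And>M. M \<ge> N \<Longrightarrow> expected (truncate g M) e x = expected g e x"
      using expected_truncate by blast
    \<comment> \<open>This truncation is long enough to reveal both the entry for \<open>e\<close>
      and \<open>x\<close> and its expected value.\<close>
    then have "expected (truncate g (N + Suc (prod_encode (e, x)))) e x = expected g e x" by simp
    then show ?thesis
      using con [of "N + Suc (prod_encode (e, x))" e x 0] pos [of "prod_encode (e, x)"] that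
      by (simp add: inconsistent_def Let_def truncate_def [of g _ "prod_encode (e, x)"])
  qed
  have "g (prod_encode (e, x)) = univ e x" for e x
  proof (induction e arbitrary: x rule: less_induct)
    case (less e)
    show ?case
    proof (cases "pfst e = 0")
      case True
      then show ?thesis
        using exp [of e x] univ_eq_expected [of e x] by (simp add: expected_def)
    next
      case False
      note IH = less.IH [OF arg_less(1) [OF False]] less.IH [OF arg_less(2) [OF False]]
      consider "pfst e = 1 \<or> pfst e = 2" | "pfst e = 3" | "\<not> pfst e \<le> 3" using False by linarith
      then show ?thesis
      proof cases
        case 1
        then have "expected g e x = expected universal e x"
          by (auto simp: expected_def Let_def IH)
        then show ?thesis
          using exp [of e x] univ_eq_expected [of e x] univ_pos [of e x] 1 by auto
      next
        case 2
        have "g (prod_encode (e, prod_encode (n, y))) = univ e (prod_encode (n, y))" for n y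
        proof (induction n)
          case 0
          have "expected g e (prod_encode (0, y)) = expected universal e (prod_encode (0, y))"
            using 2 by (simp add: expected_def IH)
          then show ?case
            using exp [of e "prod_encode (0, y)"] univ_eq_expected [of e "prod_encode (0, y)"]
              univ_pos [of e "prod_encode (0, y)"] 2 by auto
        next
          case (Suc n)
          have "expected g e (prod_encode (Suc n, y)) = expected universal e (prod_encode (Suc n, y))"
            using 2 by (simp add: expected_def Let_def IH Suc)
          then show ?case
            using exp [of e "prod_encode (Suc n, y)"] univ_eq_expected [of e "prod_encode (Suc n, y)"]
              univ_pos [of e "prod_encode (Suc n, y)"] 2 by auto
        qed
        from this [of "pfst x" "psnd x"] show ?thesis by simp
      next
        case 3
        let ?c = "g (prod_encode (e, x))" and ?a = "left_arg e"
        have hit: "mu_hit g ?a x n \<longleftrightarrow> mu_hit universal ?a x n" for n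
          by (simp add: mu_hit_def IH)
        have big: "\<exists>N. prod_encode (e, x) < N \<and> (\<forall>m\<le>n. prod_encode (?a, prod_encode (m, x)) < N)" for n
        proof -
          let ?I = "insert (prod_encode (e, x)) ((\<lambda>m. prod_encode (?a, prod_encode (m, x))) ` {..n})"
          have "finite ?I" by simp
          then show ?thesis unfolding finite_nat_set_iff_bounded by auto
        qed
        show ?thesis
        proof (cases "?c = 1")
          case True
          have "\<not> mu_hit universal ?a x n" for n
          proof
            assume "mu_hit universal ?a x n"
            moreover obtain N where "prod_encode (e, x) < N" "\<forall>m\<le>n. prod_encode (?a, prod_encode (m, x)) < N"
              using big by blast
            ultimately have "inconsistent (truncate g N) e x n"
              using 3 True hit [of n] by (auto simp: inconsistent_def Let_def mu_hit_def truncate_def)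
            then show False using con by blast
          qed
          then show ?thesis using True univ_mu [OF 3] by simp
        next
          case False
          then have c: "?c \<ge> 2" using pos [of "prod_encode (e, x)"] by linarith
          obtain N where N: "prod_encode (e, x) < N" "\<forall>m\<le>?c - 2. prod_encode (?a, prod_encode (m, x)) < N"
            using big by blast
          then have hit_c: "g (prod_encode (?a, prod_encode (?c - 2, x))) \<in> {0, 2}"
            and hit_m: "m < ?c - 2 \<Longrightarrow> g (prod_encode (?a, prod_encode (m, x))) \<notin> {1, 2}" for m
            using con [of N e x 0] 3 c by (auto simp: inconsistent_def Let_def truncate_def)
          \<comment> \<open>Consistency excludes only known wrong answers; positivity turns this
            into an actual hit at \<open>?c - 2\<close>.\<close>
          have "mu_hit g ?a x (?c - 2)"
            unfolding mu_hit_def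
          proof (intro conjI allI impI)
            show "g (prod_encode (?a, prod_encode (?c - 2, x))) = 2"
              using hit_c pos [of "prod_encode (?a, prod_encode (?c - 2, x))"] by auto
            show "2 < g (prod_encode (?a, prod_encode (m, x)))" if "m < ?c - 2" for m
              using hit_m [OF that] pos [of "prod_encode (?a, prod_encode (m, x))"] by auto
          qed
          then have "univ e x = ?c - 2 + 2" using hit univ_mu_eq [OF 3] by blast
          then show ?thesis using c by simp
        qed
      qed
    qed
  qed
  then show ?thesis by (metis ext prod_encode_pfst_psnd universal_prod_encode)
qed

lemma truncate_eq_code_nth: "truncate g N = code_nth (code_restrict g N)"
  by (rule ext) (simp add: truncate_def code_nth_restrict)

lemma computable_in_expected [computable_intros]:
  assumes "computable_in orc Z" "computable_in orc E" "computable_in orc X"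
  shows "computable_in orc (\<lambda>n. expected (code_nth (Z n)) (E n) (X n))"
  unfolding expected_def Let_def base_fun_def by (intro computable_intros assms)

lemma decidable_in_inconsistent:
  "decidable_in orc (\<lambda>w. inconsistent (code_nth (pfst w)) (pfst (psnd w))
    (pfst (psnd (psnd w))) (psnd (psnd (psnd w))))"
  unfolding inconsistent_def mu_hit_def Let_def if_bool_eq_disj insert_iff empty_iff
  by (intro computable_intros)

lemma Sigma01_compl_universal: "Sigma01 baire_basis ((- {universal}) \<times> UNIV)"
proof -
  \<comment> \<open>The second coordinate \<open>0\<close> codes the empty sequence and leaves
    \<open>x\<close> free. The witness \<open>psnd t\<close> is read as a triple in the first
    alternative and as a position with entry \<open>0\<close> in the second.\<close>
  define T where "T t \<longleftrightarrow> psnd (pfst t) = 0 \<and>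
    (inconsistent (code_nth (pfst (pfst t))) (pfst (psnd t)) (pfst (psnd (psnd t))) (psnd (psnd (psnd t)))
     \<or> psnd t < code_length (pfst (pfst t)) \<and> code_nth (pfst (pfst t)) (psnd t) = 0)" for t
  have "decidable_in Map.empty T"
    unfolding T_def
    using decidable_in_comp [OF decidable_in_inconsistent, of _ "\<lambda>t. prod_encode (pfst (pfst t), psnd t)"]
    by (intro computable_intros) (simp add: computable_intros)
  moreover have "g \<noteq> universal \<longleftrightarrow> (\<exists>t. hits baire_basis T g x t)" for g x
  proof
    assume "g \<noteq> universal"
    then consider i where "g i = 0" | N e y n where "inconsistent (truncate g N) e y n"
      using consistent_eq_universal by blast
    then show "\<exists>t. hits baire_basis T g x t"
    proof cases
      case 1
      then have "hits baire_basis T g x (prod_encode (prod_encode (code_restrict g (Suc i), 0), i))"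
        by (simp add: hits_def T_def baire_basis_def cylinder_def [of "[]"] code_nth_restrict)
      then show ?thesis ..
    next
      case 2
      then have "hits baire_basis T g x
          (prod_encode (prod_encode (code_restrict g N, 0), prod_encode (e, prod_encode (y, n))))"
        by (simp add: hits_def T_def baire_basis_def cylinder_def [of "[]"] truncate_eq_code_nth)
      then show ?thesis ..
    qed
  next
    assume "\<exists>t. hits baire_basis T g x t"
    then obtain t where "T t" and g: "g \<in> cylinder (list_decode (pfst (pfst t)))"
      unfolding hits_def by blast
    \<comment> \<open>Past its end the code reads \<open>0\<close>, so every nonzero entry is an
      entry of \<open>g\<close>.\<close>
    have nth: "code_nth (pfst (pfst t)) i = g i" if "code_nth (pfst (pfst t)) i \<noteq> 0 \<or> i < code_length (pfst (pfst t))" for i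
      using g that unfolding mem_cylinder_decode by (cases "i < code_length (pfst (pfst t))") (auto simp: code_nth_def)
    show "g \<noteq> universal"
    proof
      assume "g = universal"
      then have "\<not> inconsistent (code_nth (pfst (pfst t))) e y n" for e y n
        using nth by (intro not_inconsistent_universal) auto
      then have "universal (psnd t) = 0"
        using \<open>T t\<close> nth [of "psnd t"] \<open>g = universal\<close> unfolding T_def by simp
      then show False
        using univ_pos [of "pfst (psnd t)" "psnd (psnd t)"] by (simp add: universal_def)
    qed
  qed
  ultimately show ?thesis unfolding Sigma01_iff by (intro exI [of _ T]) auto
qed

section \<open>Universality\<close>

definition yields :: "nat \<Rightarrow> nat \<Rightarrow> nat \<Rightarrow> bool" where
  "yields e x y \<longleftrightarrow> univ e x = y + 2"

definition base_code :: "nat \<Rightarrow> nat" where "base_code a = prod_encode (0, prod_encode (a, 0))"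
definition pair_code :: "nat \<Rightarrow> nat \<Rightarrow> nat" where "pair_code a b = prod_encode (1, prod_encode (a, b))"
definition comp_code :: "nat \<Rightarrow> nat \<Rightarrow> nat" where "comp_code a b = prod_encode (2, prod_encode (a, b))"
definition rec_code :: "nat \<Rightarrow> nat \<Rightarrow> nat" where "rec_code a b = prod_encode (3, prod_encode (a, b))"
definition mu_code :: "nat \<Rightarrow> nat" where "mu_code a = prod_encode (4, prod_encode (a, 0))"

lemma yields_zero: "yields (base_code 0) x 0"
  and yields_Suc: "yields (base_code 1) x (Suc x)"
  and yields_pred: "yields (base_code 2) x (x - 1)"
  and yields_pfst: "yields (base_code 3) x (pfst x)"
  and yields_psnd: "yields (base_code 4) x (psnd x)"
  by (simp_all add: yields_def univ.simps [of "base_code _"] base_fun_def, simp_all add: base_code_def base_fun_def)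

lemma yields_pair: "yields a x u \<Longrightarrow> yields b x v \<Longrightarrow> yields (pair_code a b) x (prod_encode (u, v))"
  unfolding yields_def by (subst univ.simps) (simp add: pair_code_def)

lemma yields_comp: "yields b x u \<Longrightarrow> yields a u v \<Longrightarrow> yields (comp_code a b) x v"
  unfolding yields_def by (subst univ.simps) (simp add: comp_code_def)

lemma yields_rec_0: "yields a y u \<Longrightarrow> yields (rec_code a b) (prod_encode (0, y)) u"
  unfolding yields_def by (subst univ.simps) (simp add: rec_code_def)

lemma yields_rec_Suc:
  assumes "yields (rec_code a b) (prod_encode (n, y)) v"
    and "yields b (prod_encode (prod_encode (n, v), y)) u"
  shows "yields (rec_code a b) (prod_encode (Suc n, y)) u"
  using assms univ_eq_expected [of "rec_code a b" "prod_encode (Suc n, y)"]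
  by (simp add: yields_def rec_code_def expected_def)

lemma yields_mu:
  assumes "yields a (prod_encode (n, x)) 0" "\<And>m. m < n \<Longrightarrow> \<exists>y>0. yields a (prod_encode (m, x)) y"
  shows "yields (mu_code a) x n"
proof -
  have "mu_hit universal (left_arg (mu_code a)) x n"
    using assms by (force simp: mu_hit_def yields_def mu_code_def)
  then show ?thesis
    unfolding yields_def by (intro univ_mu_eq) (simp_all add: mu_code_def)
qed

definition cons_code :: "nat \<Rightarrow> nat \<Rightarrow> nat" where
  "cons_code a b = comp_code (base_code 1) (pair_code a b)"

lemma yields_cons:
  assumes "yields a x u" "yields b x (list_encode us)"
  shows "yields (cons_code a b) x (list_encode (u # us))"
  using yields_comp [OF yields_pair [OF assms] yields_Suc] by (simp add: cons_code_def)

lemma yields_drop: "\<exists>e. \<forall>xs. yields e (list_encode xs) (list_encode (drop i xs))"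
proof (induction i)
  case 0
  \<comment> \<open>The identity is not a base function; pairing the two projections provides
    it.\<close>
  have "yields (pair_code (base_code 3) (base_code 4)) x x" for x
    using yields_pair [OF yields_pfst yields_psnd, of x] by simp
  then show ?case by auto
next
  case (Suc i)
  then obtain e where e: "\<And>xs. yields e (list_encode xs) (list_encode (drop i xs))" by blast
  have "yields (comp_code (comp_code (base_code 4) (base_code 2)) e) (list_encode xs)
      (list_encode (drop (Suc i) xs))" for xs
  proof -
    have "psnd (list_encode ys - 1) = list_encode (tl ys)" for ys by (cases ys) auto
    then show ?thesis
      using yields_comp [OF e yields_comp [OF yields_pred yields_psnd], of xs]
      by (simp add: drop_Suc tl_drop)
  qed
  then show ?case by blast
qed

inductive_cases evals_ZeroE: "evals orc Zero xs y"
inductive_cases evals_SuccE: "evals orc Succ xs y"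
inductive_cases evals_ProjE: "evals orc (Proj i) xs y"
inductive_cases evals_QueryE: "evals orc Query xs y"
inductive_cases evals_CompE: "evals orc (Comp c hs) xs y"
inductive_cases evals_PrimRecE: "evals orc (PrimRec c d) xs y"
inductive_cases evals_PrimRec_0E: "evals orc (PrimRec c d) (0 # xs) y"
inductive_cases evals_PrimRec_SucE: "evals orc (PrimRec c d) (Suc n # xs) y"
inductive_cases evals_MuE: "evals orc (Mu c) xs y"

text \<open>Each scheme is compiled into a unary program that receives the argument list as one
  code. Only halting computations are simulated; with the empty oracle \<open>Query\<close> never
  halts.\<close>

lemma evals_yields: "\<exists>e. \<forall>xs y. evals Map.empty c xs y \<longrightarrow> yields e (list_encode xs) y"
proof (induction c)
  case Zero
  then show ?case by (blast elim: evals_ZeroE intro: yields_zero)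
next
  case Succ
  have "yields (comp_code (base_code 1) (comp_code (base_code 3) (base_code 2))) (list_encode [x]) (Suc x)" for x
    using yields_comp [OF yields_comp [OF yields_pred yields_pfst] yields_Suc, of "list_encode [x]"] by simp
  then show ?case by (blast elim: evals_SuccE)
next
  case (Proj i)
  obtain e where e: "\<And>xs. yields e (list_encode xs) (list_encode (drop i xs))"
    using yields_drop by blast
  have "yields (comp_code (comp_code (base_code 3) (base_code 2)) e) (list_encode xs) (xs ! i)"
    if "i < length xs" for xs
    using yields_comp [OF e yields_comp [OF yields_pred yields_pfst], of xs] that
    by (simp flip: Cons_nth_drop_Suc)
  then show ?case by (blast elim: evals_ProjE)
next
  case Query
  then show ?case by (auto elim: evals_QueryE)
next
  case (Comp c hs)
  then obtain ec where ec: "\<And>xs y. evals Map.empty c xs y \<Longrightarrow> yields ec (list_encode xs) y" by blast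
  have "\<exists>e. \<forall>xs ys. list_all2 (\<lambda>h y. evals Map.empty h xs y) hs ys \<longrightarrow>
      yields e (list_encode xs) (list_encode ys)"
    using Comp.IH(2)
  proof (induction hs)
    case Nil
    have "yields (base_code 0) x (list_encode [])" for x using yields_zero by simp
    then show ?case by auto
  next
    case (Cons h hs)
    obtain eh where eh: "\<And>xs y. evals Map.empty h xs y \<Longrightarrow> yields eh (list_encode xs) y"
      using Cons.prems by fastforce
    have "\<exists>e. \<forall>xs ys. list_all2 (\<lambda>h y. evals Map.empty h xs y) hs ys \<longrightarrow>
        yields e (list_encode xs) (list_encode ys)"
      by (rule Cons.IH) (use Cons.prems in auto)
    then obtain e where e: "\<And>xs ys. list_all2 (\<lambda>h y. evals Map.empty h xs y) hs ys \<Longrightarrow>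
        yields e (list_encode xs) (list_encode ys)" by blast
    show ?case
      by (intro exI [of _ "cons_code eh e"] allI impI) (auto simp: list_all2_Cons1 intro!: yields_cons eh e
        simp del: list_encode.simps)
  qed
  then obtain e where e: "\<And>xs ys. list_all2 (\<lambda>h y. evals Map.empty h xs y) hs ys \<Longrightarrow>
      yields e (list_encode xs) (list_encode ys)" by blast
  show ?case
    by (rule exI [of _ "comp_code ec e"]) (auto elim!: evals_CompE intro!: yields_comp [OF e] ec)
next
  case (PrimRec c d)
  then obtain ec ed where ec: "\<And>xs y. evals Map.empty c xs y \<Longrightarrow> yields ec (list_encode xs) y"
    and ed: "\<And>xs y. evals Map.empty d xs y \<Longrightarrow> yields ed (list_encode xs) y" by blast
  \<comment> \<open>\<open>r\<close> rearranges the nested pair delivered by the unary recursion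
    into the argument list that \<open>d\<close> expects.\<close>
  define r where "r = cons_code (comp_code (base_code 3) (base_code 3))
    (cons_code (comp_code (base_code 4) (base_code 3)) (base_code 4))"
  have r: "yields r (prod_encode (prod_encode (n, v), list_encode xs)) (list_encode (n # v # xs))" for n v xs
  proof -
    let ?x = "prod_encode (prod_encode (n, v), list_encode xs)"
    have "yields (comp_code (base_code 3) (base_code 3)) ?x n"
      using yields_comp [OF yields_pfst yields_pfst, of ?x] by simp
    moreover have "yields (comp_code (base_code 4) (base_code 3)) ?x v"
      using yields_comp [OF yields_pfst yields_psnd, of ?x] by simp
    moreover have "yields (base_code 4) ?x (list_encode xs)"
      using yields_psnd [of ?x] by simp
    ultimately show ?thesis unfolding r_def by (intro yields_cons)
  qed
  define e where "e = rec_code ec (comp_code ed r)"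
  have e: "yields e (prod_encode (n, list_encode xs)) y"
    if "evals Map.empty (PrimRec c d) (n # xs) y" for n xs y
    using that
  proof (induction n arbitrary: y)
    case 0
    then show ?case unfolding e_def by (elim evals_PrimRec_0E) (intro yields_rec_0 ec)
  next
    case (Suc n)
    from Suc.prems obtain v where "evals Map.empty (PrimRec c d) (n # xs) v" "evals Map.empty d (n # v # xs) y"
      by (elim evals_PrimRec_SucE)
    then show ?case
      using Suc.IH unfolding e_def by (blast intro: yields_rec_Suc yields_comp r ed)
  qed
  have "yields (comp_code e (base_code 2)) (list_encode xs) y" if "evals Map.empty (PrimRec c d) xs y" for xs y
  proof -
    from \<open>evals Map.empty (PrimRec c d) xs y\<close> obtain n ys where xs: "xs = n # ys"
      by (rule evals_PrimRecE) auto
    have "yields (base_code 2) (list_encode xs) (prod_encode (n, list_encode ys))"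
      using yields_pred [of "list_encode xs"] by (simp add: xs)
    then show ?thesis using e that unfolding xs by (blast intro: yields_comp)
  qed
  then show ?case by blast
next
  case (Mu c)
  then obtain ec where ec: "\<And>xs y. evals Map.empty c xs y \<Longrightarrow> yields ec (list_encode xs) y" by blast
  let ?e = "comp_code ec (base_code 1)"
  have e: "yields ?e (prod_encode (n, list_encode xs)) y" if "evals Map.empty c (n # xs) y" for n xs y
    using yields_comp [OF yields_Suc] ec [OF that] by simp
  have "yields (mu_code ?e) (list_encode xs) n" if "evals Map.empty (Mu c) xs n" for xs n
    using that by (elim evals_MuE) (intro yields_mu; blast intro: e)
  then show ?case by blast
qed

lemma computable_in_univ:
  assumes "computable_in Map.empty h"
  obtains e where "\<And>n. univ e n = h n + 2"
proof -
  obtain c where "\<And>n. evals Map.empty c [n] (h n)"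
    using assms unfolding computable_in_def by blast
  then obtain e where e: "\<And>n. yields e (list_encode [n]) (h n)"
    using evals_yields [of c] by blast
  let ?id = "pair_code (base_code 3) (base_code 4)"
  have "yields ?id n n" for n
    using yields_pair [OF yields_pfst yields_psnd, of n] by simp
  moreover have "yields (base_code 0) n (list_encode [])" for n using yields_zero by simp
  ultimately have "yields (comp_code e (cons_code ?id (base_code 0))) n (h n)" for n
    by (blast intro: yields_comp yields_cons e)
  then show ?thesis using that unfolding yields_def by blast
qed

lemma not_computably_dominated_universal: "\<not> computably_dominated universal"
proof
  assume "computably_dominated universal"
  moreover have "universal \<le>\<^sub>T universal"
    unfolding turing_le_iff by (intro computable_intros)
  ultimately obtain h where h: "computable h" "\<And>n. universal n \<le> h n"
    unfolding computably_dominated_def by blast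
  have "computable_in Map.empty (\<lambda>n. h (prod_encode (n, n)))"
    using h(1) unfolding computable_iff by (rule computable_in_comp) (intro computable_intros)
  then obtain e where "\<And>n. univ e n = h (prod_encode (n, n)) + 2" by (rule computable_in_univ) blast
  then show False using h(2) [of "prod_encode (e, e)"] by simp
qed

section \<open>The graph of the universal function\<close>

definition graph_set :: "nat \<Rightarrow> nat" where
  "graph_set k = of_bool (universal (pfst k) = psnd k)"

lemma graph_set_eq_1_iff [simp]: "graph_set (prod_encode (k, v)) = Suc 0 \<longleftrightarrow> universal k = v"
  by (simp add: graph_set_def)

lemma graph_set_cantor: "graph_set \<in> cantor_space"
  by (simp add: cantor_space_def graph_set_def)

lemma universal_equiv_graph_set: "universal \<equiv>\<^sub>T graph_set"
  unfolding turing_equiv_def turing_le_iff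
proof
  have "computable_in (Some \<circ> universal) (\<lambda>k. of_bool (universal (pfst k) = psnd k))"
    by (intro computable_intros)
  then show "computable_in (Some \<circ> universal) graph_set" by (simp flip: graph_set_def)
  have "computable_in (Some \<circ> graph_set) (\<lambda>k. LEAST v. graph_set (prod_encode (k, v)) = 1)"
    by (rule computable_in_Least) (intro computable_intros, simp)
  moreover have "(LEAST v. graph_set (prod_encode (k, v)) = 1) = universal k" for k
    by (rule Least_equality) auto
  ultimately show "computable_in (Some \<circ> graph_set) universal" by simp
qed

text \<open>The index \<open>n\<close> codes a pair of a computable length function and a computable functional on finite
  sequences. Differing from \<open>diag\<close> at \<open>n\<close> diagonalizes against this truth-table reduction.\<close>

definition diag :: "nat \<Rightarrow> nat" where
  "diag n = univ (psnd n) (prod_encode (code_restrict graph_set (univ (pfst n) n - 2), n))"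

text \<open>A finite piece of the graph can confirm values of \<open>universal\<close>: two entries
  verify the length and then the output of the functional. Taking both truth values for
  \<open>c\<close> makes \<open>{n. diag n \<noteq> 3}\<close> decidable from the graph.\<close>

lemma Sigma01_diag:
  obtains S where "Sigma01 nat_basis S" "sect S graph_set = {n. (diag n \<noteq> 3) = c}"
proof
  \<comment> \<open>\<open>a\<close> is the proposed raw value of the length function, hence the
    shift by \<open>2\<close>; \<open>z\<close> is the proposed initial segment and \<open>b\<close>
    the proposed \<open>diag n\<close>. The value \<open>3\<close> encodes output
    \<open>1\<close>.\<close>
  define T where "T t \<longleftrightarrow> (let y = pfst (pfst t); n = psnd (pfst t); a = pfst (psnd t);
      z = pfst (psnd (psnd t)); b = psnd (psnd (psnd t)) in
    code_nth y (prod_encode (prod_encode (pfst n, n), a)) = 1 \<and>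
    code_length z = a - 2 \<and> code_prefix z y \<and>
    code_nth y (prod_encode (prod_encode (psnd n, prod_encode (z, n)), b)) = 1 \<and> (b \<noteq> 3 \<longleftrightarrow> c))" for t
  have "decidable_in Map.empty T"
    unfolding T_def Let_def iff_conv_conj_imp [of "\<not> _"] by (intro computable_intros)
  then show "Sigma01 nat_basis {(g, n). \<exists>t. hits nat_basis T g n t}"
    unfolding Sigma01_iff by blast
  have "(\<exists>t. hits nat_basis T graph_set n t) \<longleftrightarrow> (diag n \<noteq> 3) = c" for n
  proof
    assume "\<exists>t. hits nat_basis T graph_set n t"
    then obtain t where t: "hits nat_basis T graph_set n t" ..
    define y a z b where yazb: "y = pfst (pfst t)" "a = pfst (psnd t)"
      "z = pfst (psnd (psnd t))" "b = psnd (psnd (psnd t))"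
    have y: "graph_set \<in> cylinder (list_decode y)" and n: "n = psnd (pfst t)"
      using t by (simp_all add: hits_def nat_basis_def yazb)
    have T: "code_nth y (prod_encode (prod_encode (pfst n, n), a)) = 1"
      "code_length z = a - 2" "code_prefix z y"
      "code_nth y (prod_encode (prod_encode (psnd n, prod_encode (z, n)), b)) = 1" "b \<noteq> 3 \<longleftrightarrow> c"
      using t unfolding hits_def T_def Let_def yazb n by auto
    have nth: "universal k = v" if "code_nth y (prod_encode (k, v)) = 1" for k v
    proof -
      have "prod_encode (k, v) < code_length y" using that by (auto simp: code_nth_def split: if_splits)
      then have "graph_set (prod_encode (k, v)) = 1"
        using y that by (simp only: mem_cylinder_decode)
      then show ?thesis by simp
    qed
    have "univ (pfst n) n = a" using nth [OF T(1)] by simp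
    moreover have "z = code_restrict graph_set (a - 2)"
      using code_prefix_cylinder [OF T(3) y] T(2) by (simp add: mem_cylinder_iff_restrict)
    ultimately have "diag n = b" using nth [OF T(4)] by (simp add: diag_def)
    then show "(diag n \<noteq> 3) = c" using T(5) by simp
  next
    assume c: "(diag n \<noteq> 3) = c"
    define a where "a = univ (pfst n) n"
    define z where "z = code_restrict graph_set (a - 2)"
    let ?i = "prod_encode (prod_encode (pfst n, n), a)"
    let ?j = "prod_encode (prod_encode (psnd n, prod_encode (z, n)), diag n)"
    let ?N = "Suc (?i + ?j + a)"
    have "graph_set ?i = 1" by (simp add: a_def)
    moreover have "graph_set ?j = 1" by (simp add: diag_def a_def z_def)
    moreover have "code_prefix z (code_restrict graph_set ?N)"
      by (auto simp: code_prefix_def z_def code_nth_restrict)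
    ultimately have "hits nat_basis T graph_set n (prod_encode (prod_encode (code_restrict graph_set ?N, n),
        prod_encode (a, prod_encode (z, diag n))))"
      using c by (simp add: hits_def T_def nat_basis_def code_nth_restrict z_def del: graph_set_eq_1_iff)
    then show "\<exists>t. hits nat_basis T graph_set n t" ..
  qed
  then show "sect {(g, n). \<exists>t. hits nat_basis T g n t} graph_set = {n. (diag n \<noteq> 3) = c}"
    by (auto simp: sect_def)
qed

text \<open>Koenig's lemma: without a uniform \<open>t\<close>, the finite sequences above which no
  \<open>t\<close> suffices contain an infinite path; its limit lies in Cantor space and contradicts
  the first hypothesis.\<close>

lemma cantor_compact:
  assumes K: "\<And>Z. Z \<in> cantor_space \<Longrightarrow> \<exists>t. K (code_restrict Z t)"
    and mono: "\<And>Z s t. K (code_restrict Z s) \<Longrightarrow> s \<le> t \<Longrightarrow> K (code_restrict Z t)"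
  shows "\<exists>t. \<forall>Z \<in> cantor_space. K (code_restrict Z t)"
proof (rule ccontr)
  assume neg: "\<not> ?thesis"
  define bad where "bad y \<longleftrightarrow> (\<forall>t. \<exists>Z \<in> cantor_space. Z \<in> cylinder y \<and> \<not> K (code_restrict Z t))" for y
  have bad_Nil: "bad []" using neg by (auto simp: bad_def cylinder_def)
  have bad_step: "\<exists>i. bad (y @ [i])" if y: "bad y" for y
  proof (rule ccontr)
    assume "\<not> ?thesis"
    then have "\<exists>t. \<forall>Z \<in> cantor_space. Z \<in> cylinder (y @ [i]) \<longrightarrow> K (code_restrict Z t)" for i
      unfolding bad_def by blast
    then obtain t where t: "\<And>i Z. Z \<in> cantor_space \<Longrightarrow> Z \<in> cylinder (y @ [i]) \<Longrightarrow> K (code_restrict Z (t i))"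
      by metis
    \<comment> \<open>The sum dominates the bounds of both one-bit extensions, and
      \<open>mono\<close> carries either bound up to it.\<close>
    obtain Z where Z: "Z \<in> cantor_space" "Z \<in> cylinder y" "\<not> K (code_restrict Z (t 0 + t 1))"
      using y unfolding bad_def by blast
    have "Z (length y) \<in> {0, 1}" using Z(1) unfolding cantor_space_def by blast
    then have "t (Z (length y)) \<le> t 0 + t 1" by auto
    moreover have "Z \<in> cylinder (y @ [Z (length y)])"
      using Z(2) by (auto simp: cylinder_def nth_append less_Suc_eq)
    ultimately show False using t Z mono by blast
  qed
  obtain f where f: "\<And>n. bad (f n) \<and> length (f n) = n" "\<And>n. \<exists>i. f (Suc n) = f n @ [i]"
    using dependent_nat_choice [of "\<lambda>n y. bad y \<and> length y = n" "\<lambda>n y y'. \<exists>i. y' = y @ [i]"]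
      bad_Nil bad_step by (metis length_append_singleton list.size(3))
  define Z where "Z n = f (Suc n) ! n" for n
  have f_eq: "f n = map Z [0..<n]" for n
  proof (induction n)
    case 0
    then show ?case using f(1) [of 0] by simp
  next
    case (Suc n)
    then show ?case using f(1) [of n] f(2) [of n] by (auto simp: Z_def nth_append)
  qed
  have agree: "Y \<in> cylinder (f n) \<longleftrightarrow> (\<forall>i<n. Y i = Z i)" for Y n
    by (simp add: cylinder_def f_eq)
  \<comment> \<open>Every initial segment of \<open>Z\<close> is bad and so extends to a point of
    Cantor space, which makes its entries bits.\<close>
  have "Z \<in> cantor_space"
  proof -
    have "Z n \<in> {0, 1}" for n
    proof -
      obtain Y where Y: "Y \<in> cantor_space" "Y \<in> cylinder (f (Suc n))"
        using f(1) unfolding bad_def by blast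
      then have "Y n = Z n" using agree [of Y "Suc n"] by simp
      moreover have "Y n \<in> {0, 1}" using Y(1) unfolding cantor_space_def by blast
      ultimately show ?thesis by simp
    qed
    then show ?thesis unfolding cantor_space_def by blast
  qed
  then obtain t where t: "K (code_restrict Z t)" using K by blast
  obtain Y where Y: "Y \<in> cylinder (f t)" "\<not> K (code_restrict Y t)"
    using f(1) unfolding bad_def by blast
  then have "code_restrict Y t = code_restrict Z t"
    using agree by (simp add: code_restrict_def list_encode_eq)
  then show False using t Y(2) by simp
qed

text \<open>The largest code of a binary sequence of length \<open>t\<close>, as pairing is
  monotone; it turns quantification over these sequences into a bounded one.\<close>

definition ones_code :: "nat \<Rightarrow> nat" where "ones_code t = list_encode (replicate t 1)"

lemma computable_in_ones_code [computable_intros]: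
  assumes "computable_in orc F"
  shows "computable_in orc (\<lambda>n. ones_code (F n))"
proof -
  have "ones_code t = rec_nat 0 (\<lambda>_ v. Suc (prod_encode (1, v))) t" for t
    by (induction t) (simp_all add: ones_code_def)
  moreover have "computable_in orc (\<lambda>n. rec_nat 0 (\<lambda>_ v. Suc (prod_encode (1, v))) (F n))"
    by (intro computable_intros assms)
  ultimately show ?thesis by simp
qed

lemma prod_encode_mono:
  assumes "a \<le> a'" "b \<le> b'"
  shows "prod_encode (a, b) \<le> prod_encode (a', b')"
proof -
  have "mono triangle" by (simp add: mono_iff_le_Suc)
  then show ?thesis using assms by (simp add: prod_encode_def add_mono monoD)
qed

lemma code_restrict_le_ones_code:
  assumes "Z \<in> cantor_space"
  shows "code_restrict Z t \<le> ones_code t"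
proof -
  have "\<forall>x \<in> set xs. x \<in> {0, 1} \<Longrightarrow> list_encode xs \<le> ones_code (length xs)" for xs
    by (induction xs) (auto simp: ones_code_def intro: prod_encode_mono)
  from this [of "map Z [0..<t]"] show ?thesis
    using assms unfolding cantor_space_def code_restrict_def by auto
qed

lemma not_strongly_relativizes_graph_set: "\<not> strongly_relativizes_Delta01 nat_basis graph_set"
proof
  assume sr: "strongly_relativizes_Delta01 nat_basis graph_set"
  let ?A = graph_set
  obtain U where U: "Sigma01 nat_basis U" "sect U ?A = {n. (diag n \<noteq> 3) = True}" by (rule Sigma01_diag)
  obtain V where V: "Sigma01 nat_basis V" "sect V ?A = {n. (diag n \<noteq> 3) = False}" by (rule Sigma01_diag)
  have "Delta01_in nat_basis ?A {n. diag n \<noteq> 3}"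
    unfolding Delta01_in_def by (rule exI [of _ U], rule exI [of _ V]) (use U V in auto)
  then obtain Q where "Delta01 nat_basis Q" and Q: "{n. diag n \<noteq> 3} = sect Q ?A"
    using sr unfolding strongly_relativizes_Delta01_def by blast
  then obtain P R where P: "decidable_in Map.empty P" "Q = {(g, x). \<exists>s. hits nat_basis P g x s}"
    and R: "decidable_in Map.empty R" "- Q = {(g, x). \<exists>s. hits nat_basis R g x s}"
    unfolding Delta01_def Sigma01_iff by blast
  \<comment> \<open>Bounding the stage by the length of \<open>z\<close> makes \<open>K\<close>
    decidable for decidable \<open>S\<close> and lets a certificate survive extension of
    \<open>z\<close>.\<close>
  define K where "K S z n \<longleftrightarrow>
    (\<exists>s<code_length z. S s \<and> psnd (pfst s) = n \<and> code_prefix (pfst (pfst s)) z)" for S z n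
  have K_imp: "\<exists>s. hits nat_basis S Z n s" if "K S (code_restrict Z t) n" for S Z t n
    using that code_prefix_cylinder [OF _ mem_cylinder_restrict [of Z t]]
    unfolding K_def hits_def nat_basis_def by blast
  have K_dec: "decidable_in Map.empty (\<lambda>w. K S (pfst w) (psnd w))" if "decidable_in Map.empty S" for S
    unfolding K_def by (intro computable_intros decidable_in_comp [OF that])
  \<comment> \<open>\<open>S\<close> merges the enumerations of \<open>Q\<close> and of its
    complement, so every point is eventually hit.\<close>
  define S where "S s \<longleftrightarrow> P s \<or> R s" for s
  have S: "decidable_in Map.empty S" unfolding S_def by (intro computable_intros P R)
  have "\<exists>t. \<forall>Z \<in> cantor_space. K S (code_restrict Z t) n" for n
  proof (rule cantor_compact)
    fix Z
    obtain s where s: "hits nat_basis S Z n s"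
    proof -
      have "(Z, n) \<in> Q \<or> (Z, n) \<in> - Q" by blast
      then have "\<exists>s. hits nat_basis P Z n s \<or> hits nat_basis R Z n s" unfolding R(2) unfolding P(2) by blast
      then show ?thesis using that unfolding S_def hits_def by blast
    qed
    let ?t = "Suc s"
    have "code_length (pfst (pfst s)) \<le> s" by (meson code_length_le pfst_le le_trans)
    then have "K S (code_restrict Z ?t) n"
      using s code_prefix_iff_cylinder [OF mem_cylinder_restrict [of Z ?t], of "pfst (pfst s)"]
      unfolding K_def hits_def nat_basis_def by auto
    then show "\<exists>t. K S (code_restrict Z t) n" ..
  next
    fix Z s t
    assume "K S (code_restrict Z s) n" "s \<le> t"
    then show "K S (code_restrict Z t) n"
      unfolding K_def code_prefix_def by (auto simp: code_nth_restrict intro: less_le_trans)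
  qed
  \<comment> \<open>Every binary code is an initial segment of its own extension by zeros, so the
    compactness bound applies to all binary codes.\<close>
  moreover have "\<exists>Z \<in> cantor_space. z = code_restrict Z (code_length z)"
    if "\<forall>i<code_length z. code_nth z i < 2" for z
  proof (intro bexI)
    show "code_nth z \<in> cantor_space"
      using that by (force simp: cantor_space_def code_nth_def less_2_cases_iff)
    show "z = code_restrict (code_nth z) (code_length z)"
      by (simp flip: mem_cylinder_iff_restrict add: mem_cylinder_decode)
  qed
  ultimately have ex: "\<exists>t. \<forall>z<Suc (ones_code t).
      code_length z = t \<and> (\<forall>i<t. code_nth z i < 2) \<longrightarrow> K S z n" for n
    by metis
  \<comment> \<open>\<open>q\<close> is the use bound of the truth-table reduction: at this length
    every binary sequence settles membership of \<open>n\<close>.\<close>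
  define q where "q n = (LEAST t. \<forall>z<Suc (ones_code t).
      code_length z = t \<and> (\<forall>i<t. code_nth z i < 2) \<longrightarrow> K S z n)" for n
  have "decidable_in Map.empty (\<lambda>p. K S (psnd p) (pfst (pfst p)))"
    using decidable_in_comp [OF K_dec [OF S], of "\<lambda>p. prod_encode (psnd p, pfst (pfst p))"]
    by (simp add: computable_intros)
  then have "computable_in Map.empty q"
    unfolding q_def by (intro computable_in_Least ex) (intro computable_intros)
  then obtain e where e: "\<And>n. univ e n = q n + 2" by (rule computable_in_univ) blast
  obtain d where d: "\<And>w. univ d w = of_bool (K P (pfst w) (psnd w)) + 2"
    using computable_in_univ [OF K_dec [OF P(1), unfolded decidable_in_def]] by blast
  \<comment> \<open>\<open>e\<close> computes the use bound and \<open>d\<close> evaluates the truth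
    table, so \<open>diag n\<close> runs the reduction on its own index.\<close>
  define n where "n = prod_encode (e, d)"
  let ?z = "code_restrict ?A (q n)"
  have "\<forall>z<Suc (ones_code (q n)). code_length z = q n \<and> (\<forall>i<q n. code_nth z i < 2) \<longrightarrow> K S z n"
    unfolding q_def by (rule LeastI_ex [OF ex])
  moreover have "?z < Suc (ones_code (q n))"
    using code_restrict_le_ones_code [OF graph_set_cantor] by (simp add: less_Suc_eq_le)
  ultimately have "K S ?z n" by (auto simp: code_nth_restrict graph_set_def)
  then have "K P ?z n \<or> K R ?z n" unfolding K_def S_def by blast
  \<comment> \<open>At most one side can be certified, since \<open>P\<close> and \<open>R\<close>
    enumerate complementary sets.\<close>
  then have "K P ?z n \<longleftrightarrow> (?A, n) \<in> Q"
    using K_imp P(2) R(2) by blast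
  moreover have "(?A, n) \<in> Q \<longleftrightarrow> diag n \<noteq> 3" using Q by (auto simp: sect_def)
  \<comment> \<open>A positive verdict has raw value \<open>3\<close>, so the diagonal set reverses
    the verdict at \<open>n\<close>.\<close>
  moreover have "diag n \<noteq> 3 \<longleftrightarrow> \<not> K P ?z n" by (simp add: diag_def n_def e d)
  ultimately show False by blast
qed

theorem theorem20:
  "(\<exists>f A. A \<in> cantor_space \<and>
      strongly_relativizes_Delta01 baire_basis f \<and> f \<equiv>\<^sub>T A \<and>
      \<not> strongly_relativizes_Delta01 baire_basis A \<and>
      \<not> strongly_relativizes_Delta01 nat_basis A) \<and>
   (\<exists>f. strongly_relativizes_Delta01 baire_basis f \<and> \<not> computably_dominated f)"
  \<comment> \<open>The witnesses are \<open>universal\<close> and \<open>graph_set\<close>; failure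
    at the natural numbers entails failure at Baire space by contraposition.\<close>
  using graph_set_cantor strongly_relativizes_if_singleton [OF Sigma01_compl_universal]
    universal_equiv_graph_set not_strongly_relativizes_graph_set strongly_relativizes_nat_if_baire
    not_computably_dominated_universal
  by blast

end
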